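(* For each $n$ let $(X_1,Y_1),\dots,(X_n,Y_n)$ be i.i.d. with $Y_i=\beta^TX_i+\epsilon_i$, $\beta\in\mathbb{R}^p$, $E(\epsilon_i\mid X_i)=0$, $E(\epsilon_i^2\mid X_i)=\sigma^2$. Assume $X_i\overset{i.i.d.}{\sim}N(\mathbf{0},\mathbf{I})$ in $\mathbb{R}^p$ and $\epsilon_1,\dots,\epsilon_n\sim N(0,\sigma^2)$. Let $\tau^2=\|\beta\|^2$, with $\tau^2+\sigma^2>0$. If, as $n,p\to\infty$, $\tau^2+\sigma^2$ is bounded and $p/n$ converges to a constant, then $$\sqrt n\left(\frac{\hat\tau^2-\tau^2}{\psi}\right)\overset{D}{\rightarrow}N(0,1),$$ where $\psi>0$ is given by $$\psi^2=2\left\{\left(1+\frac pn\right)(\sigma^2+\tau^2)^2-\sigma^4+3\tau^4\right\}.$$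
   Context: Asymptotics: $n$ and $p=p_n$ go to infinity together; $\beta$ and $\sigma^2$ may depend on $n$. $W_{ij}=X_{ij}Y_i$, and the naive estimator of $\tau^2$ is $\hat\tau^2=\frac{1}{n(n-1)}\sum_{j=1}^p\sum_{i_1\ne i_2}W_{i_1j}W_{i_2j}$. $\overset{D}{\rightarrow}$ denotes convergence in distribution. *)

theory Defs
  imports "HOL-Probability.Probability"
begin

text \<open>A vector of \<open>\<real>\<^sup>p\<close> is a function in \<^term>\<open>space (PiM {..<p} (\<lambda>_. borel :: real measure))\<close>, so that
  the dimension \<^term>\<open>p\<close> may vary with the sample size.\<close>

abbreviation Rvec :: "nat \<Rightarrow> (nat \<Rightarrow> real) measure" where
  "Rvec p \<equiv> PiM {..<p} (\<lambda>_. borel)"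

definition std_normal_vec :: "nat \<Rightarrow> (nat \<Rightarrow> real) measure" where
  "std_normal_vec p = PiM {..<p} (\<lambda>_. std_normal_distribution)"

text \<open>\<open>N(\<mu>, \<sigma>\<^sup>2)\<close>, parametrised by the standard deviation; \<open>\<sigma> = 0\<close> gives the point mass at \<open>\<mu>\<close>
  (the library's \<^const>\<open>normal_density\<close> is the zero function there).\<close>

definition normal_distr :: "real \<Rightarrow> real \<Rightarrow> real measure" where
  "normal_distr \<mu> \<sigma> =
     (if \<sigma> = 0 then return borel \<mu> else density lborel (normal_density \<mu> \<sigma>))"

definition sigma_gen :: "'a measure \<Rightarrow> nat \<Rightarrow> ('a \<Rightarrow> nat \<Rightarrow> real) \<Rightarrow> 'a measure" where
  "sigma_gen M p V = vimage_algebra (space M) V (Rvec p)"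

definition sqnorm :: "nat \<Rightarrow> (nat \<Rightarrow> real) \<Rightarrow> real" where
  "sqnorm p b = (\<Sum>j<p. (b j)\<^sup>2)"

text \<open>Observations are indexed by \<open>i < n\<close> and coordinates by \<open>j < p\<close>.\<close>

definition W :: "(nat \<Rightarrow> 'a \<Rightarrow> nat \<Rightarrow> real) \<Rightarrow> (nat \<Rightarrow> 'a \<Rightarrow> real) \<Rightarrow> nat \<Rightarrow> nat \<Rightarrow> 'a \<Rightarrow> real" where
  "W X Y i j \<omega> = X i \<omega> j * Y i \<omega>"

definition tau2_hat ::
  "nat \<Rightarrow> nat \<Rightarrow> (nat \<Rightarrow> 'a \<Rightarrow> nat \<Rightarrow> real) \<Rightarrow> (nat \<Rightarrow> 'a \<Rightarrow> real) \<Rightarrow> 'a \<Rightarrow> real" where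
  "tau2_hat n p X Y \<omega> =
     1 / (real n * (real n - 1)) *
       (\<Sum>j<p. \<Sum>i1<n. \<Sum>i2\<in>{..<n} - {i1}. W X Y i1 j \<omega> * W X Y i2 j \<omega>)"

definition psi :: "nat \<Rightarrow> nat \<Rightarrow> real \<Rightarrow> real \<Rightarrow> real" where
  "psi n p tau2 sigma2 =
     sqrt (2 * ((1 + real p / real n) * (sigma2 + tau2)\<^sup>2 - sigma2\<^sup>2 + 3 * tau2\<^sup>2))"

end

theory Submission
  imports Defs
begin

text \<open>
  Rescale so that \<open>\<tau>\<^sup>2 + \<sigma>\<^sup>2 = 1\<close> and put \<open>V\<^sub>i = W\<^sub>i - \<beta>\<close>, whose covariance is \<open>I + \<beta>\<beta>\<^sup>T\<close>. The standardised
  statistic is a sum of martingale differences \<open>V\<^sub>i \<bullet> (\<alpha> \<beta> + \<gamma> P\<^sub>i)\<close> with \<open>P\<^sub>i = V\<^sub>0 + \<dots> + V\<^sub>i\<^sub>-\<^sub>1\<close>. Given the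
  past, the \<open>i\<close>-th difference has variance \<open>|c|\<^sup>2 + (\<beta> \<bullet> c)\<^sup>2\<close> at \<open>c = \<alpha> \<beta> + \<gamma> P\<^sub>i\<close>, and this is close in \<open>L\<^sup>1\<close> to a
  deterministic \<open>v\<^sub>i\<close> because \<open>|P\<^sub>i|\<^sup>2\<close> concentrates around \<open>i p\<close> as \<open>n, p \<rightarrow> \<infinity>\<close>. Hence multiplying the
  characteristic function of the partial sum by \<open>exp (- t\<^sup>2 v\<^sub>i / 2)\<close> is a good approximation to one step;
  telescoping the \<open>n\<close> steps, with \<open>\<Sum>v\<^sub>i \<rightarrow> 1\<close>, gives a bound that tends to zero, and Levy's continuity theorem
  concludes. The fourth moments of \<open>V\<^sub>i\<close> are controlled through eighth moments of \<open>X\<close> and \<open>\<epsilon>\<close> separately,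
  since \<open>\<epsilon>\<close> is only conditionally uncorrelated with \<open>X\<close>, not independent of it.
\<close>

text \<open>Rescaling makes every error bound depend on n, p and t alone, so that \<beta> and
  \<sigma> may vary freely with n. The differences come from Hoeffding's decomposition of a
  U-statistic: inserting W = V + \<beta> splits the statistic into a linear part, with weight
  \<alpha>, and a degenerate quadratic part, with weight \<gamma>. Neither dominates in general, so
  one martingale carries both. The spike b b^T in the covariance comes from the signal: for Gaussian
  X the signal contributes |c|^2 |b|^2 + (c.b)^2 to the variance of c.V and the noise contributes (1
  - |b|^2) |c|^2. The obstacle is that the conditional variance of a step is random. Comparing it
  with a deterministic number keeps the comparison factor outside the expectation; each step then
  costs o(1/n), and since the later factors are at most 1 these errors merely add. Concentration
  rests on the variance of |P_i|^2 being of order n p^2 + n^2 p, which is small against (n p)^2 only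
  if both n and p grow.\<close>

definition dot :: "nat \<Rightarrow> (nat \<Rightarrow> real) \<Rightarrow> (nat \<Rightarrow> real) \<Rightarrow> real" where
  "dot p u v = (\<Sum>j<p. u j * v j)"

lemma sqnorm_nonneg: "0 \<le> sqnorm p u"
  by (simp add: sqnorm_def sum_nonneg)

lemma sqnorm_eq_dot: "sqnorm p u = dot p u u"
  by (simp add: sqnorm_def dot_def power2_eq_square)

lemma dot_commute: "dot p u v = dot p v u"
  by (simp add: dot_def mult.commute)

lemma dot_add_left: "dot p (\<lambda>j. u j + v j) w = dot p u w + dot p v w"
  by (simp add: dot_def algebra_simps sum.distrib)

lemma dot_scale_left: "dot p (\<lambda>j. a * u j) w = a * dot p u w"
  by (simp add: dot_def algebra_simps sum_distrib_left)

lemma dot_diff_left: "dot p (\<lambda>j. u j - v j) w = dot p u w - dot p v w"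
  by (simp add: dot_def algebra_simps sum_subtractf)

lemma dot_add_right: "dot p w (\<lambda>j. u j + v j) = dot p w u + dot p w v"
  by (simp add: dot_def algebra_simps sum.distrib)

lemma dot_diff_right: "dot p w (\<lambda>j. u j - v j) = dot p w u - dot p w v"
  by (simp add: dot_def algebra_simps sum_subtractf)

lemma dot_scale_right: "dot p w (\<lambda>j. a * u j) = a * dot p w u"
  by (simp add: dot_def algebra_simps sum_distrib_left)

lemmas dot_simps = dot_add_left dot_scale_left dot_diff_left
  dot_add_right dot_scale_right dot_diff_right

lemma dot_restrict_right [simp]: "dot p u (restrict v {..<p}) = dot p u v"
  by (simp add: dot_def)

lemma dot_Cauchy_Schwarz: "(dot p u v)\<^sup>2 \<le> sqnorm p u * sqnorm p v"
  unfolding dot_def sqnorm_def by (rule Cauchy_Schwarz_ineq_sum)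

lemma dot_unit: "j < p \<Longrightarrow> dot p (\<lambda>k. if k = j then 1 else 0) v = v j"
proof -
  assume "j < p"
  have "dot p (\<lambda>k. if k = j then 1 else 0) v = (\<Sum>k<p. if k = j then v k else 0)"
    unfolding dot_def by (rule sum.cong) auto
  then show ?thesis using \<open>j < p\<close> by simp
qed

lemma sqnorm_add: "sqnorm p (\<lambda>j. u j + v j) = sqnorm p u + 2 * dot p u v + sqnorm p v"
  by (simp add: sqnorm_eq_dot dot_simps dot_commute[of p v u])

lemma sqnorm_add_le: "sqnorm p (\<lambda>j. u j + v j) \<le> 2 * sqnorm p u + 2 * sqnorm p v"
proof -
  have "0 \<le> sqnorm p (\<lambda>j. u j - v j)" by (rule sqnorm_nonneg)
  then show ?thesis
    by (simp add: sqnorm_eq_dot dot_simps dot_commute[of p v u])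
qed

lemma sqnorm_scale: "sqnorm p (\<lambda>j. a * u j) = a\<^sup>2 * sqnorm p u"
  by (simp add: sqnorm_eq_dot dot_simps power2_eq_square)

lemma measurable_dot [measurable (raw)]:
  assumes "\<And>j. j < p \<Longrightarrow> (\<lambda>x. u x j) \<in> borel_measurable N"
    and "\<And>j. j < p \<Longrightarrow> (\<lambda>x. v x j) \<in> borel_measurable N"
  shows "(\<lambda>x. dot p (u x) (v x)) \<in> borel_measurable N"
  unfolding dot_def using assms by (auto intro!: borel_measurable_sum borel_measurable_times)

lemma measurable_sqnorm [measurable (raw)]:
  assumes "\<And>j. j < p \<Longrightarrow> (\<lambda>x. u x j) \<in> borel_measurable N"
  shows "(\<lambda>x. sqnorm p (u x)) \<in> borel_measurable N"
  unfolding sqnorm_eq_dot by (intro measurable_dot assms)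

lemma square_sum_le: "(x + y)\<^sup>2 \<le> 2 * x\<^sup>2 + 2 * (y::real)\<^sup>2"
  using sum_squares_bound[of x y] by (simp add: power2_sum)

text \<open>Fubini for the product law of the pair. The second variable \<omega>' ranges over a copy
  of the same space, so the inner integral is the conditional expectation given A with A frozen.
  Both variables share a value type because \<open>indep_var\<close> demands it.\<close>

lemma (in prob_space) indep_var_integral_iterated:
  fixes f :: "'b \<times> 'b \<Rightarrow> 'd::{banach, second_countable_topology}"
  assumes ind: "indep_var S A T B"
    and f [measurable]: "f \<in> borel_measurable (S \<Otimes>\<^sub>M T)"
    and int: "integrable M (\<lambda>\<omega>. f (A \<omega>, B \<omega>))"
  shows "integrable M (\<lambda>\<omega>. \<integral>\<omega>'. f (A \<omega>, B \<omega>') \<partial>M)"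
    and "(\<integral>\<omega>. f (A \<omega>, B \<omega>) \<partial>M) = (\<integral>\<omega>. (\<integral>\<omega>'. f (A \<omega>, B \<omega>') \<partial>M) \<partial>M)"
proof -
  have A [measurable]: "random_variable S A" and B [measurable]: "random_variable T B"
    and eq: "distr M S A \<Otimes>\<^sub>M distr M T B = distr M (S \<Otimes>\<^sub>M T) (\<lambda>\<omega>. (A \<omega>, B \<omega>))"
    using ind by (auto simp: indep_var_distribution_eq)
  interpret DA: prob_space "distr M S A" by (rule prob_space_distr) simp
  interpret DB: prob_space "distr M T B" by (rule prob_space_distr) simp
  interpret pair_prob_space "distr M S A" "distr M T B" ..
  have int': "integrable (distr M S A \<Otimes>\<^sub>M distr M T B) f"
    using int unfolding eq by (simp add: integrable_distr_eq)
  have inner: "(\<integral>y. f (x, y) \<partial>distr M T B) = (\<integral>\<omega>'. f (x, B \<omega>') \<partial>M)" if "x \<in> space S" for x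
    using that by (subst integral_distr) (auto intro: measurable_Pair2)
  have "integrable (distr M S A) (\<lambda>x. \<integral>y. f (x, y) \<partial>distr M T B)"
    using int' by (rule integrable_fst')
  then have "integrable M (\<lambda>\<omega>. \<integral>y. f (A \<omega>, y) \<partial>distr M T B)"
    by (subst (asm) integrable_distr_eq) auto
  then show "integrable M (\<lambda>\<omega>. \<integral>\<omega>'. f (A \<omega>, B \<omega>') \<partial>M)"
    by (rule Bochner_Integration.integrable_cong[THEN iffD1, rotated 2])
      (auto intro!: inner measurable_space[OF A])
  have "(\<integral>\<omega>. f (A \<omega>, B \<omega>) \<partial>M) = (\<integral>z. f z \<partial>(distr M S A \<Otimes>\<^sub>M distr M T B))"
    unfolding eq by (simp add: integral_distr)
  also have "\<dots> = (\<integral>x. (\<integral>y. f (x, y) \<partial>distr M T B) \<partial>distr M S A)"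
    using int' by (rule integral_fst'[symmetric])
  also have "\<dots> = (\<integral>\<omega>. (\<integral>y. f (A \<omega>, y) \<partial>distr M T B) \<partial>M)"
    by (subst integral_distr) auto
  also have "\<dots> = (\<integral>\<omega>. (\<integral>\<omega>'. f (A \<omega>, B \<omega>') \<partial>M) \<partial>M)"
    by (rule Bochner_Integration.integral_cong) (auto intro!: inner measurable_space[OF A])
  finally show "(\<integral>\<omega>. f (A \<omega>, B \<omega>) \<partial>M) = (\<integral>\<omega>. (\<integral>\<omega>'. f (A \<omega>, B \<omega>') \<partial>M) \<partial>M)" .
qed

text \<open>Positivity of the variance of |X|. It converts second-moment bounds into the L1 bounds
  needed for the conditional variance.\<close>

lemma (in prob_space) expectation_abs_le_sqrt:
  assumes [measurable]: "X \<in> borel_measurable M" and int: "integrable M (\<lambda>\<omega>. (X \<omega>)\<^sup>2)"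
    and le: "(\<integral>\<omega>. (X \<omega>)\<^sup>2 \<partial>M) \<le> (a::real)"
  shows "integrable M X" and "(\<integral>\<omega>. \<bar>X \<omega>\<bar> \<partial>M) \<le> sqrt a"
proof -
  show iX: "integrable M X" by (rule square_integrable_imp_integrable[OF _ int]) simp
  have "0 \<le> variance (\<lambda>\<omega>. \<bar>X \<omega>\<bar>)" by (rule variance_positive)
  also have "\<dots> = (\<integral>\<omega>. (X \<omega>)\<^sup>2 \<partial>M) - (\<integral>\<omega>. \<bar>X \<omega>\<bar> \<partial>M)\<^sup>2"
    using iX int by (subst variance_eq) auto
  finally have "(\<integral>\<omega>. \<bar>X \<omega>\<bar> \<partial>M)\<^sup>2 \<le> a" using le by simp
  then show "(\<integral>\<omega>. \<bar>X \<omega>\<bar> \<partial>M) \<le> sqrt a" by (rule real_le_rsqrt)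
qed

section \<open>A martingale central limit bound for quadratic forms in independent vectors\<close>

text \<open>Requiring \<open>E_dot2\<close> for every c says, by polarisation, that each V has
  covariance I + b b^T, a rank-one spike on the identity. The bounds on \<alpha> and \<gamma> make
  each of the n steps have variance O(1/n).\<close>

locale spiked_sample = prob_space M for M :: "'a measure" +
  fixes n p :: nat and V :: "nat \<Rightarrow> 'a \<Rightarrow> nat \<Rightarrow> real" and b :: "nat \<Rightarrow> real"
    and K \<alpha> \<gamma> :: real
  assumes indep_V: "indep_vars (\<lambda>_. Rvec p) V {..<n}"
    and p_pos: "0 < p"
    and b_le: "sqnorm p b \<le> 1"
    and int_V4: "\<And>i. i < n \<Longrightarrow> integrable M (\<lambda>\<omega>. (sqnorm p (V i \<omega>))\<^sup>2)"
    and E_V4: "\<And>i. i < n \<Longrightarrow> (\<integral>\<omega>. (sqnorm p (V i \<omega>))\<^sup>2 \<partial>M) \<le> K * (real p)\<^sup>2"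
    and E_dot: "\<And>i c. i < n \<Longrightarrow> (\<integral>\<omega>. dot p c (V i \<omega>) \<partial>M) = 0"
    and E_dot2: "\<And>i c. i < n \<Longrightarrow> (\<integral>\<omega>. (dot p c (V i \<omega>))\<^sup>2 \<partial>M) = sqnorm p c + (dot p b c)\<^sup>2"
    and E_dot4: "\<And>i c. i < n \<Longrightarrow> (\<integral>\<omega>. (dot p c (V i \<omega>))^4 \<partial>M) \<le> K * (sqnorm p c)\<^sup>2"
    and alpha_nonneg: "0 \<le> \<alpha>" and gamma_nonneg: "0 \<le> \<gamma>"
    and alpha_le: "\<alpha>\<^sup>2 * sqnorm p b \<le> 1 / real n"
    and gamma_le: "\<gamma>\<^sup>2 * real p \<le> 8 / (real n)\<^sup>2"
begin

abbreviation "q \<equiv> sqnorm p b"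
text \<open>\<open>m\<close> is the trace of the covariance I + b b^T, and \<open>Q\<close> below is
  its quadratic form.\<close>

abbreviation "m \<equiv> real p + q"
abbreviation "Q c \<equiv> sqnorm p c + (dot p b c)\<^sup>2"

lemma rv_V: "i < n \<Longrightarrow> random_variable (Rvec p) (V i)"
  using indep_V by (auto simp: indep_vars_def)

lemma rv_V_component [measurable (raw)]:
  assumes "i < n" "j < p" shows "(\<lambda>\<omega>. V i \<omega> j) \<in> borel_measurable M"
  using assms(2) by (intro measurable_compose[OF rv_V[OF assms(1)]] measurable_component_singleton) simp

lemma q_nonneg: "0 \<le> q"
  by (rule sqnorm_nonneg)

lemma Q_le: "Q c \<le> 2 * sqnorm p c"
proof -
  have "(dot p b c)\<^sup>2 \<le> sqnorm p b * sqnorm p c" by (rule dot_Cauchy_Schwarz)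
  also have "\<dots> \<le> 1 * sqnorm p c" by (intro mult_right_mono b_le sqnorm_nonneg)
  finally show ?thesis by simp
qed

lemma Q_nonneg: "0 \<le> Q c"
  by (simp add: sqnorm_nonneg)

lemma m_le: "m \<le> 2 * real p"
  using b_le p_pos by simp

lemma integrable_dominated:
  fixes f :: "'a \<Rightarrow> real"
  assumes "i < n" and "f \<in> borel_measurable M"
    and "\<And>\<omega>. \<bar>f \<omega>\<bar> \<le> a + c * (sqnorm p (V i \<omega>))\<^sup>2"
  shows "integrable M f"
proof (rule Bochner_Integration.integrable_bound)
  show "integrable M (\<lambda>\<omega>. a + c * (sqnorm p (V i \<omega>))\<^sup>2)"
    using int_V4[OF assms(1)] by simp
  show "AE \<omega> in M. norm (f \<omega>) \<le> norm (a + c * (sqnorm p (V i \<omega>))\<^sup>2)"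
    using assms(3) by (intro AE_I2) (metis abs_ge_self order_trans real_norm_def)
qed fact

lemma integrable_dot4: "i < n \<Longrightarrow> integrable M (\<lambda>\<omega>. (dot p c (V i \<omega>))^4)"
proof (rule integrable_dominated[where a=0 and c="(sqnorm p c)\<^sup>2"])
  fix \<omega>
  have "(dot p c (V i \<omega>))^4 = ((dot p c (V i \<omega>))\<^sup>2)\<^sup>2" by simp
  also have "\<dots> \<le> (sqnorm p c * sqnorm p (V i \<omega>))\<^sup>2"
    by (intro power_mono dot_Cauchy_Schwarz) simp
  finally show "\<bar>dot p c (V i \<omega>)^4\<bar> \<le> 0 + (sqnorm p c)\<^sup>2 * (sqnorm p (V i \<omega>))\<^sup>2"
    by (simp add: power_mult_distrib)
qed measurable

lemma integrable_dot2: "i < n \<Longrightarrow> integrable M (\<lambda>\<omega>. (dot p c (V i \<omega>))\<^sup>2)"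
  by (rule square_integrable_imp_integrable) (use integrable_dot4[of i c] in \<open>simp_all add: rv_V_component\<close>)

lemma integrable_dot: "i < n \<Longrightarrow> integrable M (\<lambda>\<omega>. dot p c (V i \<omega>))"
  by (rule square_integrable_imp_integrable) (use integrable_dot2[of i c] in simp_all)

lemma integrable_sqnorm: "i < n \<Longrightarrow> integrable M (\<lambda>\<omega>. sqnorm p (V i \<omega>))"
  by (rule square_integrable_imp_integrable) (use int_V4[of i] in simp_all)

lemma E_sqnorm: "i < n \<Longrightarrow> (\<integral>\<omega>. sqnorm p (V i \<omega>) \<partial>M) = m"
proof -
  assume i: "i < n"
  let ?e = "\<lambda>j k. if k = j then 1 else (0::real)"
  have 1: "(V i \<omega> j)\<^sup>2 = (dot p (?e j) (V i \<omega>))\<^sup>2" if "j < p" for j \<omega>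
    using that by (simp add: dot_unit)
  have 2: "sqnorm p (?e j) = 1" "dot p b (?e j) = b j" if "j < p" for j
    using that by (simp_all add: sqnorm_eq_dot dot_commute[of p b] dot_unit)
  have "(\<integral>\<omega>. sqnorm p (V i \<omega>) \<partial>M) = (\<Sum>j<p. \<integral>\<omega>. (dot p (?e j) (V i \<omega>))\<^sup>2 \<partial>M)"
    unfolding sqnorm_def
    by (subst Bochner_Integration.integral_sum[symmetric])
      (auto intro!: Bochner_Integration.integral_cong sum.cong integrable_dot2 i simp: 1)
  also have "\<dots> = (\<Sum>j<p. 1 + (b j)\<^sup>2)"
    by (intro sum.cong refl) (simp add: E_dot2[OF i] 2)
  finally show ?thesis by (simp add: sum.distrib sqnorm_def)
qed

text \<open>p <= E|V|^2 <= (E|V|^4)^(1/2) <= sqrt K * p. This supplies the sign of K in all later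
  monotonicity arguments.\<close>

lemma K_ge_1: "i < n \<Longrightarrow> 1 \<le> K"
proof -
  assume i: "i < n"
  have "(\<integral>\<omega>. \<bar>sqnorm p (V i \<omega>)\<bar> \<partial>M) \<le> sqrt (K * (real p)\<^sup>2)"
    by (rule expectation_abs_le_sqrt(2)[OF _ int_V4[OF i] E_V4[OF i]]) (use i in measurable)
  then have le: "m \<le> sqrt (K * (real p)\<^sup>2)"
    using E_sqnorm[OF i] by (simp add: sqnorm_nonneg)
  then have "real p \<le> sqrt (K * (real p)\<^sup>2)" using q_nonneg by simp
  then have "(real p)\<^sup>2 \<le> K * (real p)\<^sup>2"
    by (smt (verit) of_nat_0_le_iff power2_le_iff_abs_le real_sqrt_abs real_sqrt_le_iff real_sqrt_pow2_iff)
  then show "1 \<le> K" using p_pos by simp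
qed

text \<open>The restriction to \<open>{..<p}\<close> places each value in the space of
  \<open>Rvec p\<close>, as measurability into that product space requires.\<close>

definition P :: "nat \<Rightarrow> 'a \<Rightarrow> nat \<Rightarrow> real" where
  "P i \<omega> = (\<lambda>j\<in>{..<p}. \<Sum>k<i. V k \<omega> j)"

lemma dot_P_0 [simp]: "dot p c (P 0 \<omega>) = 0"
  by (simp add: P_def dot_def)

lemma dot_P_Suc: "dot p c (P (Suc i) \<omega>) = dot p c (P i \<omega>) + dot p c (V i \<omega>)"
  by (simp add: P_def dot_def algebra_simps sum.distrib)

lemma sqnorm_P_0 [simp]: "sqnorm p (P 0 \<omega>) = 0"
  by (simp add: P_def sqnorm_def)

lemma sqnorm_P_Suc:
  "sqnorm p (P (Suc i) \<omega>) = sqnorm p (P i \<omega>) + 2 * dot p (P i \<omega>) (V i \<omega>) + sqnorm p (V i \<omega>)"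
  by (simp add: P_def dot_def sqnorm_def algebra_simps power2_sum sum.distrib sum_distrib_left)

definition S :: "nat \<Rightarrow> 'a \<Rightarrow> real" where
  "S i \<omega> = (\<Sum>k<i. dot p (\<lambda>j. \<alpha> * b j + \<gamma> * P k \<omega> j) (V k \<omega>))"

lemma S_0 [simp]: "S 0 \<omega> = 0"
  by (simp add: S_def)

lemma S_Suc: "S (Suc i) \<omega> = S i \<omega> + dot p (\<lambda>j. \<alpha> * b j + \<gamma> * P i \<omega> j) (V i \<omega>)"
  by (simp add: S_def)

lemma rv_P_component [measurable (raw)]:
  assumes "i \<le> n" "j < p" shows "(\<lambda>\<omega>. P i \<omega> j) \<in> borel_measurable M"
  unfolding P_def using assms by simp

lemma rv_S [measurable (raw)]: "i \<le> n \<Longrightarrow> S i \<in> borel_measurable M"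
  unfolding S_def by measurable

text \<open>Conditioning on the past in the form of an iterated integral. The past is recorded as
  the pair of P and S because the characteristic function step needs both.\<close>

lemma integral_past:
  fixes f :: "((nat \<Rightarrow> real) \<times> real) \<times> (nat \<Rightarrow> real) \<Rightarrow> 'd::{banach, second_countable_topology}"
  assumes i: "i < n"
    and f [measurable]: "f \<in> borel_measurable ((Rvec p \<Otimes>\<^sub>M borel) \<Otimes>\<^sub>M Rvec p)"
    and int: "integrable M (\<lambda>\<omega>. f ((P i \<omega>, S i \<omega>), V i \<omega>))"
  shows "integrable M (\<lambda>\<omega>. \<integral>\<omega>'. f ((P i \<omega>, S i \<omega>), V i \<omega>') \<partial>M)"
    and "(\<integral>\<omega>. f ((P i \<omega>, S i \<omega>), V i \<omega>) \<partial>M) = (\<integral>\<omega>. (\<integral>\<omega>'. f ((P i \<omega>, S i \<omega>), V i \<omega>') \<partial>M) \<partial>M)"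
proof -
  \<comment> \<open>\<open>PP\<close> and \<open>SS\<close> rebuild P and S from the family of the
    first i vectors alone, which is independent of V i. The present is likewise packed as a family
    over \<open>{i}\<close>, to share the value type of the past.\<close>
  define PP where "PP k z = (\<lambda>j\<in>{..<p}. \<Sum>l<k. z l j)" for k and z :: "nat \<Rightarrow> nat \<Rightarrow> real"
  define SS where "SS z = (\<Sum>k<i. dot p (\<lambda>j. \<alpha> * b j + \<gamma> * PP k z j) (z k))" for z
  define F where "F x = f ((PP i (fst x), SS (fst x)), snd x i)" for x
  have comp [measurable (raw)]: "(\<lambda>z. z k j) \<in> borel_measurable (PiM A (\<lambda>_. Rvec p))"
    if "k \<in> A" "j < p" for k j and A :: "nat set"
    using that by (intro measurable_compose[OF measurable_component_singleton[of k A "\<lambda>_. Rvec p"]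
      measurable_component_singleton[of j "{..<p}" "\<lambda>_. borel"]]) auto
  have [measurable]: "PP i \<in> measurable (PiM {..<i} (\<lambda>_. Rvec p)) (Rvec p)"
    unfolding PP_def by measurable
  have "(\<lambda>z. PP k z j) \<in> borel_measurable (PiM {..<i} (\<lambda>_. Rvec p))" if "k < i" "j < p" for k j
    using that by (auto simp: PP_def intro!: borel_measurable_sum)
  then have [measurable]: "SS \<in> borel_measurable (PiM {..<i} (\<lambda>_. Rvec p))"
    unfolding SS_def by (intro borel_measurable_sum measurable_dot) (auto intro!: borel_measurable_add borel_measurable_times)
  have [measurable]: "(\<lambda>z. z i) \<in> measurable (PiM {i} (\<lambda>_. Rvec p)) (Rvec p)"
    by (rule measurable_component_singleton) simp
  have F: "F \<in> borel_measurable (PiM {..<i} (\<lambda>_. Rvec p) \<Otimes>\<^sub>M PiM {i} (\<lambda>_. Rvec p))"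
    unfolding F_def by measurable
  have PP: "PP k (\<lambda>l\<in>{..<i}. V l \<omega>) = P k \<omega>" if "k \<le> i" for k \<omega>
    using that by (auto simp: PP_def P_def intro!: restrict_ext sum.cong)
  have SS: "SS (\<lambda>l\<in>{..<i}. V l \<omega>) = S i \<omega>" for \<omega>
    unfolding SS_def S_def by (rule sum.cong) (auto simp: PP)
  have eq: "F (\<lambda>l\<in>{..<i}. V l \<omega>, \<lambda>l\<in>{i}. V l \<omega>') = f ((P i \<omega>, S i \<omega>), V i \<omega>')" for \<omega> \<omega>'
    by (simp add: F_def PP SS)
  have ind: "indep_var (PiM {..<i} (\<lambda>_. Rvec p)) (\<lambda>\<omega>. \<lambda>l\<in>{..<i}. V l \<omega>)
      (PiM {i} (\<lambda>_. Rvec p)) (\<lambda>\<omega>. \<lambda>l\<in>{i}. V l \<omega>)"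
    using i by (intro indep_var_restrict[OF indep_V]) auto
  show "integrable M (\<lambda>\<omega>. \<integral>\<omega>'. f ((P i \<omega>, S i \<omega>), V i \<omega>') \<partial>M)"
    "(\<integral>\<omega>. f ((P i \<omega>, S i \<omega>), V i \<omega>) \<partial>M) = (\<integral>\<omega>. (\<integral>\<omega>'. f ((P i \<omega>, S i \<omega>), V i \<omega>') \<partial>M) \<partial>M)"
    using indep_var_integral_iterated[OF ind F] int unfolding eq by auto
qed

lemma integral_past_real:
  fixes f :: "(nat \<Rightarrow> real) \<Rightarrow> (nat \<Rightarrow> real) \<Rightarrow> real"
  assumes i: "i < n"
    and f: "(\<lambda>x. f (fst x) (snd x)) \<in> borel_measurable (Rvec p \<Otimes>\<^sub>M Rvec p)"
    and int: "integrable M (\<lambda>\<omega>. f (P i \<omega>) (V i \<omega>))"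
  shows "integrable M (\<lambda>\<omega>. \<integral>\<omega>'. f (P i \<omega>) (V i \<omega>') \<partial>M)"
    and "(\<integral>\<omega>. f (P i \<omega>) (V i \<omega>) \<partial>M) = (\<integral>\<omega>. (\<integral>\<omega>'. f (P i \<omega>) (V i \<omega>') \<partial>M) \<partial>M)"
proof -
  have "(\<lambda>x. f (fst (fst x)) (snd x)) \<in> borel_measurable ((Rvec p \<Otimes>\<^sub>M borel) \<Otimes>\<^sub>M Rvec p)"
    by (rule measurable_compose[OF _ f, of "\<lambda>x. (fst (fst x), snd x)", simplified]) measurable
  from integral_past[OF i this] int
  show "integrable M (\<lambda>\<omega>. \<integral>\<omega>'. f (P i \<omega>) (V i \<omega>') \<partial>M)"
    and "(\<integral>\<omega>. f (P i \<omega>) (V i \<omega>) \<partial>M) = (\<integral>\<omega>. (\<integral>\<omega>'. f (P i \<omega>) (V i \<omega>') \<partial>M) \<partial>M)"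
    by simp_all
qed

lemma sqnorm_P_Suc_le:
  "(sqnorm p (P (Suc i) \<omega>))\<^sup>2 \<le> 8 * (sqnorm p (P i \<omega>))\<^sup>2 + 8 * (sqnorm p (V i \<omega>))\<^sup>2"
proof -
  have "sqnorm p (P (Suc i) \<omega>) \<le> 2 * sqnorm p (P i \<omega>) + 2 * sqnorm p (V i \<omega>)"
    using sqnorm_add_le[of p "P i \<omega>" "V i \<omega>"] by (simp add: sqnorm_P_Suc sqnorm_add)
  then have "(sqnorm p (P (Suc i) \<omega>))\<^sup>2 \<le> (2 * sqnorm p (P i \<omega>) + 2 * sqnorm p (V i \<omega>))\<^sup>2"
    by (intro power_mono sqnorm_nonneg)
  also have "\<dots> \<le> 2 * (2 * sqnorm p (P i \<omega>))\<^sup>2 + 2 * (2 * sqnorm p (V i \<omega>))\<^sup>2"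
    by (rule square_sum_le)
  finally show ?thesis by simp
qed

lemma integrable_P4: "i \<le> n \<Longrightarrow> integrable M (\<lambda>\<omega>. (sqnorm p (P i \<omega>))\<^sup>2)"
proof (induction i)
  case (Suc i)
  show ?case
  proof (rule Bochner_Integration.integrable_bound)
    show "integrable M (\<lambda>\<omega>. 8 * (sqnorm p (P i \<omega>))\<^sup>2 + 8 * (sqnorm p (V i \<omega>))\<^sup>2)"
      using Suc int_V4[of i] by auto
    show "AE \<omega> in M. norm ((sqnorm p (P (Suc i) \<omega>))\<^sup>2)
        \<le> norm (8 * (sqnorm p (P i \<omega>))\<^sup>2 + 8 * (sqnorm p (V i \<omega>))\<^sup>2)"
      using sqnorm_P_Suc_le by simp
  qed (use Suc.prems in measurable)
qed simp

lemma integrable_dominated_P: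
  fixes f :: "'a \<Rightarrow> real"
  assumes "i \<le> n" and "f \<in> borel_measurable M"
    and "\<And>\<omega>. \<bar>f \<omega>\<bar> \<le> a + c * (sqnorm p (P i \<omega>))\<^sup>2"
  shows "integrable M f"
proof (rule Bochner_Integration.integrable_bound)
  show "integrable M (\<lambda>\<omega>. a + c * (sqnorm p (P i \<omega>))\<^sup>2)"
    using integrable_P4[OF assms(1)] by simp
  show "AE \<omega> in M. norm (f \<omega>) \<le> norm (a + c * (sqnorm p (P i \<omega>))\<^sup>2)"
    using assms(3) by (intro AE_I2) (metis abs_ge_self order_trans real_norm_def)
qed fact

lemma integrable_sqnorm_P: "i \<le> n \<Longrightarrow> integrable M (\<lambda>\<omega>. sqnorm p (P i \<omega>))"
  by (rule square_integrable_imp_integrable) (use integrable_P4[of i] in simp_all)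

lemma integrable_dot2_P: "i \<le> n \<Longrightarrow> integrable M (\<lambda>\<omega>. (dot p c (P i \<omega>))\<^sup>2)"
proof (rule Bochner_Integration.integrable_bound)
  assume "i \<le> n"
  then show "integrable M (\<lambda>\<omega>. sqnorm p c * sqnorm p (P i \<omega>))"
    using integrable_sqnorm_P by simp
  show "AE \<omega> in M. norm ((dot p c (P i \<omega>))\<^sup>2) \<le> norm (sqnorm p c * sqnorm p (P i \<omega>))"
    using dot_Cauchy_Schwarz by (simp add: sqnorm_nonneg)
qed measurable

lemma integrable_dot_P: "i \<le> n \<Longrightarrow> integrable M (\<lambda>\<omega>. dot p c (P i \<omega>))"
  by (rule square_integrable_imp_integrable) (use integrable_dot2_P[of i] in simp_all)

text \<open>The new vector is centred and independent of the past, so cross terms vanish and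
  variances add.\<close>

lemma E_dot2_P: "i \<le> n \<Longrightarrow> (\<integral>\<omega>. (dot p c (P i \<omega>))\<^sup>2 \<partial>M) = real i * Q c"
proof (induction i)
  case (Suc i)
  then have i: "i < n" by simp
  have inner: "(\<integral>\<omega>'. (dot p c x + dot p c (V i \<omega>'))\<^sup>2 \<partial>M) = (dot p c x)\<^sup>2 + Q c" for x
    using integrable_dot[OF i, of c] integrable_dot2[OF i, of c] E_dot[OF i, of c] E_dot2[OF i, of c]
    by (simp add: power2_sum prob_space)
  have "(\<integral>\<omega>. (dot p c (P (Suc i) \<omega>))\<^sup>2 \<partial>M) = (\<integral>\<omega>. (\<integral>\<omega>'. (dot p c (P i \<omega>) + dot p c (V i \<omega>'))\<^sup>2 \<partial>M) \<partial>M)"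
    unfolding dot_P_Suc
  proof (rule integral_past_real(2)[OF i])
    show "integrable M (\<lambda>\<omega>. (dot p c (P i \<omega>) + dot p c (V i \<omega>))\<^sup>2)"
      using integrable_dot2_P[OF Suc.prems, of c] unfolding dot_P_Suc .
  qed measurable
  also have "\<dots> = real i * Q c + Q c"
    unfolding inner using integrable_dot2_P[of i c] Suc by (simp add: prob_space)
  finally show ?case by (simp add: algebra_simps)
qed simp

lemma integrable_dot_P_V: "i < n \<Longrightarrow> integrable M (\<lambda>\<omega>. dot p (P i \<omega>) (V i \<omega>))"
proof (rule Bochner_Integration.integrable_bound)
  assume i: "i < n"
  show "integrable M (\<lambda>\<omega>. sqnorm p (P i \<omega>) + sqnorm p (V i \<omega>))"
    using integrable_sqnorm_P[of i] integrable_sqnorm[OF i] i by simp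
  have "\<bar>dot p x y\<bar> \<le> sqnorm p x + sqnorm p y" for x y
    using sqnorm_nonneg[of p "\<lambda>j. x j - y j"] sqnorm_nonneg[of p "\<lambda>j. x j + y j"]
      sqnorm_nonneg[of p x] sqnorm_nonneg[of p y]
    by (simp add: sqnorm_eq_dot dot_simps dot_commute[of p y x])
  then show "AE \<omega> in M. norm (dot p (P i \<omega>) (V i \<omega>)) \<le> norm (sqnorm p (P i \<omega>) + sqnorm p (V i \<omega>))"
    by (simp add: sqnorm_nonneg)
qed measurable

lemma E_sqnorm_P: "i \<le> n \<Longrightarrow> (\<integral>\<omega>. sqnorm p (P i \<omega>) \<partial>M) = real i * m"
proof (induction i)
  case (Suc i)
  then have i: "i < n" by simp
  have "(\<integral>\<omega>. dot p (P i \<omega>) (V i \<omega>) \<partial>M) = (\<integral>\<omega>. (\<integral>\<omega>'. dot p (P i \<omega>) (V i \<omega>') \<partial>M) \<partial>M)"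
    by (rule integral_past_real(2)[OF i _ integrable_dot_P_V[OF i]]) measurable
  then have "(\<integral>\<omega>. dot p (P i \<omega>) (V i \<omega>) \<partial>M) = 0"
    by (simp add: E_dot[OF i])
  then show ?case
    using Suc i integrable_sqnorm_P[of i] integrable_sqnorm[OF i] integrable_dot_P_V[OF i]
    by (simp add: sqnorm_P_Suc E_sqnorm algebra_simps)
qed simp

text \<open>The centred squared norm is itself a martingale: its increment 2 P_i.V_i + (|V_i|^2 - m)
  has mean zero given the past.\<close>

abbreviation D :: "nat \<Rightarrow> 'a \<Rightarrow> real" where
  "D i \<omega> \<equiv> sqnorm p (P i \<omega>) - real i * m"

text \<open>One step of \<open>D\<close> with the past frozen at d and x: the cross term vanishes,
  and (a + b)^2 <= 2 a^2 + 2 b^2 separates the increment. The term 16 |x|^2 is 8 Q x bounded by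
  \<open>Q_le\<close>; the other is twice the variance of |V|^2.\<close>

lemma E_step_square:
  assumes i: "i < n"
  shows "(\<integral>\<omega>. (d + (2 * dot p x (V i \<omega>) + (sqnorm p (V i \<omega>) - m)))\<^sup>2 \<partial>M)
      \<le> d\<^sup>2 + (2 * K * (real p)\<^sup>2 + 16 * sqnorm p x)"
proof -
  let ?z = "\<lambda>\<omega>. 2 * dot p x (V i \<omega>) + (sqnorm p (V i \<omega>) - m)"
  let ?w = "\<lambda>\<omega>. 8 * (dot p x (V i \<omega>))\<^sup>2 + 2 * (sqnorm p (V i \<omega>) - m)\<^sup>2"
  note int = integrable_dot[OF i, of x] integrable_dot2[OF i, of x] integrable_sqnorm[OF i] int_V4[OF i]
  have iw: "integrable M ?w" using int by (simp add: power2_diff)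
  have zw: "(?z \<omega>)\<^sup>2 \<le> ?w \<omega>" for \<omega>
    using square_sum_le[of "2 * dot p x (V i \<omega>)" "sqnorm p (V i \<omega>) - m"] by simp
  have iz2: "integrable M (\<lambda>\<omega>. (?z \<omega>)\<^sup>2)"
    by (rule Bochner_Integration.integrable_bound[OF iw]) (use i zw in \<open>auto intro!: AE_I2 order_trans[OF zw]\<close>)
  have iz: "integrable M ?z" using int by simp
  have Ez: "(\<integral>\<omega>. ?z \<omega> \<partial>M) = 0" using int by (simp add: E_dot[OF i] E_sqnorm[OF i] prob_space)
  have "(\<integral>\<omega>. (d + z \<omega>)\<^sup>2 \<partial>M) = d\<^sup>2 + (\<integral>\<omega>. (z \<omega>)\<^sup>2 \<partial>M) + 2 * d * (\<integral>\<omega>. z \<omega> \<partial>M)"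
    if "integrable M z" "integrable M (\<lambda>\<omega>. (z \<omega>)\<^sup>2)" for z
    using that by (simp add: power2_sum prob_space)
  from this[OF iz iz2] have "(\<integral>\<omega>. (d + ?z \<omega>)\<^sup>2 \<partial>M)
      = d\<^sup>2 + (\<integral>\<omega>. (?z \<omega>)\<^sup>2 \<partial>M) + 2 * d * (\<integral>\<omega>. ?z \<omega> \<partial>M)" .
  also have "\<dots> \<le> d\<^sup>2 + (\<integral>\<omega>. ?w \<omega> \<partial>M)"
    unfolding Ez using integral_mono[OF iz2 iw zw] by simp
  also have "(\<integral>\<omega>. ?w \<omega> \<partial>M) = 8 * Q x + 2 * ((\<integral>\<omega>. (sqnorm p (V i \<omega>))\<^sup>2 \<partial>M) - m\<^sup>2)"
    using int by (simp add: power2_diff E_dot2[OF i] E_sqnorm[OF i] prob_space) (simp add: algebra_simps power2_eq_square)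
  also have "\<dots> \<le> 2 * K * (real p)\<^sup>2 + 16 * sqnorm p x"
  proof -
    have "8 * u + 2 * (v - w) \<le> 2 * y + 16 * s" if "v \<le> y" "u \<le> 2 * s" "0 \<le> w" for u v w y s :: real
      using that by simp
    from this[OF E_V4[OF i] Q_le[of x] zero_le_power2[of m]] show ?thesis by (simp only: mult.assoc)
  qed
  finally show ?thesis by simp
qed

lemma integrable_D2: "i \<le> n \<Longrightarrow> integrable M (\<lambda>\<omega>. (D i \<omega>)\<^sup>2)"
  using integrable_P4[of i] integrable_sqnorm_P[of i] by (simp add: power2_diff)

text \<open>Summing the step bound, with 16 E|P_i|^2 = 16 i m <= 32 n p. The result is O(n p^2 + n^2
  p), of smaller order than the squared scale (n p)^2 of |P_i|^2; this is the concentration.\<close>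

lemma E_D2: "i \<le> n \<Longrightarrow> (\<integral>\<omega>. (D i \<omega>)\<^sup>2 \<partial>M) \<le> real i * (2 * K * (real p)\<^sup>2 + 32 * real n * real p)"
proof (induction i)
  case (Suc i)
  then have i: "i < n" by simp
  let ?f = "\<lambda>x y. ((sqnorm p x - real i * m) + (2 * dot p x y + (sqnorm p y - m)))\<^sup>2"
  have D: "(D (Suc i) \<omega>)\<^sup>2 = ?f (P i \<omega>) (V i \<omega>)" for \<omega>
    by (simp add: sqnorm_P_Suc algebra_simps)
  have int: "integrable M (\<lambda>\<omega>. ?f (P i \<omega>) (V i \<omega>))"
    using integrable_D2[OF Suc.prems] unfolding D .
  have meas: "(\<lambda>x. ?f (fst x) (snd x)) \<in> borel_measurable (Rvec p \<Otimes>\<^sub>M Rvec p)"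
    by measurable
  note it = integral_past_real[of i ?f, OF i meas int]
  note int' = integrable_D2[of i] integrable_sqnorm_P[of i]
  have "(\<integral>\<omega>. (D (Suc i) \<omega>)\<^sup>2 \<partial>M) = (\<integral>\<omega>. (\<integral>\<omega>'. ?f (P i \<omega>) (V i \<omega>') \<partial>M) \<partial>M)"
    unfolding D by (rule it(2))
  also have "\<dots> \<le> (\<integral>\<omega>. (D i \<omega>)\<^sup>2 + (2 * K * (real p)\<^sup>2 + 16 * sqnorm p (P i \<omega>)) \<partial>M)"
    using i int' by (intro integral_mono it(1) E_step_square) auto
  also have "\<dots> = (\<integral>\<omega>. (D i \<omega>)\<^sup>2 \<partial>M) + (2 * K * (real p)\<^sup>2 + 16 * (real i * m))"
    using i int' by (subst Bochner_Integration.integral_add) (auto simp: E_sqnorm_P prob_space)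
  also have "\<dots> \<le> real i * (2 * K * (real p)\<^sup>2 + 32 * real n * real p) + (2 * K * (real p)\<^sup>2 + 32 * real n * real p)"
  proof -
    have "real i * m \<le> real n * (2 * real p)"
      using i by (intro mult_mono m_le) (auto simp: q_nonneg)
    then show ?thesis using Suc.IH i by simp
  qed
  finally show ?case by (simp add: algebra_simps)
qed simp

text \<open>Splits |P_i|^2 into \<open>D i\<close> and its mean i m <= 2 n p. In 72, 64 comes from
  the second term of \<open>E_D2\<close> and 8 from the squared mean; lower powers of n and p are
  then raised to squares.\<close>

lemma E_P4: "i \<le> n \<Longrightarrow> (\<integral>\<omega>. (sqnorm p (P i \<omega>))\<^sup>2 \<partial>M) \<le> (4 * K + 72) * (real n)\<^sup>2 * (real p)\<^sup>2"
proof (cases "n = 0")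
  case False
  assume i: "i \<le> n"
  have K: "1 \<le> K" using False K_ge_1[of 0] by simp
  have "(\<integral>\<omega>. (sqnorm p (P i \<omega>))\<^sup>2 \<partial>M) \<le> (\<integral>\<omega>. 2 * (D i \<omega>)\<^sup>2 + 2 * (real i * m)\<^sup>2 \<partial>M)"
    using square_sum_le[of "D i _" "real i * m"] integrable_P4[OF i] integrable_D2[OF i]
    by (intro integral_mono) auto
  also have "\<dots> = 2 * (\<integral>\<omega>. (D i \<omega>)\<^sup>2 \<partial>M) + 2 * (real i * m)\<^sup>2"
    using integrable_D2[OF i] by (simp add: prob_space)
  also have "\<dots> \<le> 2 * (real n * (2 * K * (real p)\<^sup>2 + 32 * real n * real p)) + 2 * (real n * (2 * real p))\<^sup>2"
  proof (intro add_mono mult_left_mono power_mono mult_mono m_le)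
    have "(\<integral>\<omega>. (D i \<omega>)\<^sup>2 \<partial>M) \<le> real i * (2 * K * (real p)\<^sup>2 + 32 * real n * real p)"
      by (rule E_D2[OF i])
    also have "\<dots> \<le> real n * (2 * K * (real p)\<^sup>2 + 32 * real n * real p)"
      using i K by (intro mult_right_mono) auto
    finally show "(\<integral>\<omega>. (D i \<omega>)\<^sup>2 \<partial>M) \<le> real n * (2 * K * (real p)\<^sup>2 + 32 * real n * real p)" .
  qed (use i q_nonneg in auto)
  also have "\<dots> = 4 * K * (real n * (real p)\<^sup>2) + 64 * ((real n)\<^sup>2 * real p) + 8 * ((real n)\<^sup>2 * (real p)\<^sup>2)"
    by (simp add: power2_eq_square algebra_simps)
  also have "\<dots> \<le> 4 * K * ((real n)\<^sup>2 * (real p)\<^sup>2) + 64 * ((real n)\<^sup>2 * (real p)\<^sup>2) + 8 * ((real n)\<^sup>2 * (real p)\<^sup>2)"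
    using False p_pos K by (intro add_mono mult_left_mono mult_right_mono self_le_power order_refl) auto
  finally show ?thesis by (simp add: algebra_simps)
qed simp

end

section \<open>Elementary estimates and the error terms\<close>

lemma exp_minus_bound:
  fixes y :: real
  assumes "0 \<le> y"
  shows "\<bar>(1 - y) - exp (- y)\<bar> \<le> y\<^sup>2 / 2"
proof -
  have 1: "1 - y \<le> exp (- y)" using exp_ge_add_one_self[of "- y"] by simp
  have pos: "0 < 1 + y + y\<^sup>2 / 2" using assms by (simp add: add_pos_nonneg)
  \<comment> \<open>The product is exactly 1 + y^4 / 4.\<close>
  have "1 \<le> (1 - y + y\<^sup>2 / 2) * (1 + y + y\<^sup>2 / 2)"
    using assms by (simp add: power2_eq_square algebra_simps)
  also have "\<dots> \<le> (1 - y + y\<^sup>2 / 2) * exp y"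
  proof (rule mult_left_mono[OF exp_lower_Taylor_quadratic[OF assms]])
    have "0 \<le> (1 - y)\<^sup>2 + 1" by simp
    then show "0 \<le> 1 - y + y\<^sup>2 / 2" by (simp add: power2_diff)
  qed
  finally have "exp (- y) \<le> 1 - y + y\<^sup>2 / 2" by (simp add: exp_minus field_simps)
  then show ?thesis using 1 by simp
qed

lemma exp_minus_diff_le:
  fixes x y :: real
  assumes "0 \<le> x" "0 \<le> y"
  shows "\<bar>exp (- x) - exp (- y)\<bar> \<le> \<bar>x - y\<bar>"
proof -
  have *: "exp (- x) - exp (- y) \<le> y - x" if "0 \<le> x" "x \<le> y" for x y :: real
  proof -
    have "exp (- x) - exp (- y) = exp (- x) * (1 - exp (- (y - x)))"
      by (simp add: algebra_simps flip: exp_add)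
    also have "\<dots> \<le> 1 * (y - x)"
    proof (intro mult_mono)
      show "1 - exp (- (y - x)) \<le> y - x"
        using exp_ge_add_one_self[of "- (y - x)"] by linarith
    qed (use that in auto)
    finally show ?thesis by simp
  qed
  show ?thesis using *[of x y] *[of y x] assms by (cases "x \<le> y") (auto simp: abs_if)
qed

text \<open>Weighted arithmetic-geometric mean. It trades the third moment in the Taylor remainder
  for second and fourth moments, with a weight to be chosen later.\<close>

lemma abs_cube_le:
  fixes x \<delta> :: real
  assumes "0 < \<delta>"
  shows "\<bar>x\<bar>^3 \<le> (\<delta> * x\<^sup>2 + x^4 / \<delta>) / 2"
proof -
  have "0 \<le> x\<^sup>2 * ((\<delta> - \<bar>x\<bar>)\<^sup>2 / \<delta>)" using assms by simp
  also have "\<dots> = \<delta> * x\<^sup>2 + x^4 / \<delta> - 2 * \<bar>x\<bar>^3"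
    using assms by (simp add: field_simps power2_eq_square power3_eq_cube power4_eq_xxxx abs_mult_self_eq)
  finally show ?thesis by simp
qed

text \<open>Bounds n times the mean error of one conditional variance. The three terms come from the
  cross term in b.P_i, from the fluctuation \<open>D i\<close>, and from the remaining terms i q and
  (b.P_i)^2.\<close>

definition variance_error :: "real \<Rightarrow> nat \<Rightarrow> nat \<Rightarrow> real" where
  "variance_error K n p = 16 / sqrt (real p) + 8 * sqrt (2 * K / real n + 32 / real p) + 24 / real p"

text \<open>Bounds n^2 E|C|^4: 8 comes from the linear coefficient, and 512 = 8 * 8^2 from the
  squared bound on \<gamma>^2 p, multiplied by the constant of \<open>E_P4\<close>.\<close>

definition fourth_moment_const :: "real \<Rightarrow> real" where
  "fourth_moment_const K = 8 + 512 * (4 * K + 72)"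

text \<open>In order: randomness of the conditional variances, the third-order Taylor remainder,
  replacing 1 - y by exp (- y), and the total variance differing from 1.\<close>

definition char_error :: "real \<Rightarrow> nat \<Rightarrow> nat \<Rightarrow> real \<Rightarrow> real" where
  "char_error K n p t = t\<^sup>2 / 2 * variance_error K n p
    + \<bar>t\<bar>^3 / 12 * ((10 + variance_error K n p + K * fourth_moment_const K) / sqrt (real n))
    + 25 * t^4 / (2 * real n) + t\<^sup>2 / 2 * (1 / (real n - 1))"

section \<open>Conditional variances and the characteristic function recursion\<close>

context spiked_sample
begin

abbreviation C :: "(nat \<Rightarrow> real) \<Rightarrow> nat \<Rightarrow> real" where
  "C x \<equiv> \<lambda>j. \<alpha> * b j + \<gamma> * x j"

text \<open>Deterministic proxy for the conditional variance \<open>Q (C (P i \<omega>))\<close>, obtained by replacing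
  \<open>sqnorm p (P i \<omega>)\<close> by \<open>i * p\<close> and dropping the terms in \<open>dot p b (P i \<omega>)\<close>.\<close>

definition v :: "nat \<Rightarrow> real" where
  "v i = \<alpha>\<^sup>2 * (q + q\<^sup>2) + \<gamma>\<^sup>2 * (real i * real p)"

abbreviation "G \<equiv> variance_error K n p"
abbreviation "L \<equiv> fourth_moment_const K"

lemma sqnorm_C: "sqnorm p (C x) = \<alpha>\<^sup>2 * q + 2 * \<alpha> * \<gamma> * dot p b x + \<gamma>\<^sup>2 * sqnorm p x"
  by (simp add: sqnorm_eq_dot dot_simps dot_commute[of p x b] algebra_simps power2_eq_square)

text \<open>The term i q appears because the fluctuation is centred at i m = i (p + q), whereas
  \<open>v i\<close> uses i p.\<close>

lemma Q_C_minus_v: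
  "Q (C x) - v i = 2 * \<alpha> * \<gamma> * (1 + q) * dot p b x
    + \<gamma>\<^sup>2 * ((sqnorm p x - real i * m) + real i * q + (dot p b x)\<^sup>2)"
proof -
  have "dot p b (C x) = \<alpha> * q + \<gamma> * dot p b x"
    by (simp add: sqnorm_eq_dot dot_simps)
  then show ?thesis
    unfolding sqnorm_C v_def by (simp add: algebra_simps power2_eq_square)
qed

lemma v_nonneg: "0 \<le> v i"
  by (simp add: v_def q_nonneg)

lemma v_le:
  assumes "i < n" shows "v i \<le> 10 / real n"
proof -
  have "\<alpha>\<^sup>2 * (q + q\<^sup>2) = \<alpha>\<^sup>2 * q * (1 + q)"
    by (simp add: algebra_simps power2_eq_square)
  also have "\<dots> \<le> (1 / real n) * 2"
    using b_le q_nonneg by (intro mult_mono alpha_le) auto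
  finally have 1: "\<alpha>\<^sup>2 * (q + q\<^sup>2) \<le> 2 / real n" by simp
  have "\<gamma>\<^sup>2 * (real i * real p) = (\<gamma>\<^sup>2 * real p) * real i" by simp
  also have "\<dots> \<le> (8 / (real n)\<^sup>2) * real n"
    using assms by (intro mult_mono gamma_le) auto
  also have "\<dots> = 8 / real n" by (simp add: power2_eq_square)
  finally show ?thesis using 1 by (simp add: v_def)
qed

lemma integrable_Q_C: "i \<le> n \<Longrightarrow> integrable M (\<lambda>\<omega>. Q (C (P i \<omega>)))"
proof -
  assume i: "i \<le> n"
  have "integrable M (\<lambda>\<omega>. (Q (C (P i \<omega>)) - v i) + v i)"
    unfolding Q_C_minus_v
    using integrable_dot_P[OF i, of b] integrable_dot2_P[OF i, of b] integrable_sqnorm_P[OF i] by simp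
  then show ?thesis by simp
qed

text \<open>Since \<gamma>^2 is at most of order 1 / (n^2 p), the bound of order n p sqrt (1/n +
  1/p) on E|D i| contributes o(1/n); the terms in b.P_i are smaller than |P_i|^2 by a factor of
  order p, because b is a single direction.\<close>

lemma E_abs_Q_C_minus_v:
  assumes i: "i < n"
  shows "(\<integral>\<omega>. \<bar>Q (C (P i \<omega>)) - v i\<bar> \<partial>M) \<le> G / real n"
proof -
  have n0: "0 < real n" and i': "i \<le> n" using i by auto
  have p0: "0 < real p" using p_pos by simp
  note K = K_ge_1[OF i]
  note int = integrable_dot_P[OF i', of b] integrable_dot2_P[OF i', of b] integrable_D2[OF i']
    integrable_sqnorm_P[OF i']
  have Qb: "Q b \<le> 2 * q" by (rule Q_le)
  have Eb2: "(\<integral>\<omega>. (dot p b (P i \<omega>))\<^sup>2 \<partial>M) \<le> real n * (2 * q)"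
    unfolding E_dot2_P[OF i'] using i Qb by (intro mult_mono) (auto simp: Q_nonneg)
  have Eb: "(\<integral>\<omega>. \<bar>dot p b (P i \<omega>)\<bar> \<partial>M) \<le> sqrt (real n * (2 * q))"
    using i' int(2) Eb2 by (intro expectation_abs_le_sqrt(2)) auto
  have "(\<integral>\<omega>. (D i \<omega>)\<^sup>2 \<partial>M) \<le> real n * (2 * K * (real p)\<^sup>2 + 32 * real n * real p)"
    using i K by (intro order_trans[OF E_D2[OF i']] mult_right_mono) auto
  then have ED: "(\<integral>\<omega>. \<bar>D i \<omega>\<bar> \<partial>M) \<le> sqrt (real n * (2 * K * (real p)\<^sup>2 + 32 * real n * real p))"
    using i' int(3) by (intro expectation_abs_le_sqrt(2)) auto
  have pt: "\<bar>Q (C x) - v i\<bar> \<le> 4 * (\<alpha> * \<gamma>) * \<bar>dot p b x\<bar>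
      + \<gamma>\<^sup>2 * (\<bar>sqnorm p x - real i * m\<bar> + real n + (dot p b x)\<^sup>2)" for x
  proof -
    have "\<bar>2 * \<alpha> * \<gamma> * (1 + q) * dot p b x\<bar> = (2 * (\<alpha> * \<gamma>) * (1 + q)) * \<bar>dot p b x\<bar>"
      using alpha_nonneg gamma_nonneg q_nonneg by (simp add: abs_mult)
    also have "\<dots> \<le> (2 * (\<alpha> * \<gamma>) * 2) * \<bar>dot p b x\<bar>"
      using alpha_nonneg gamma_nonneg q_nonneg b_le by (intro mult_right_mono mult_left_mono) auto
    finally have 1: "\<bar>2 * \<alpha> * \<gamma> * (1 + q) * dot p b x\<bar> \<le> 4 * (\<alpha> * \<gamma>) * \<bar>dot p b x\<bar>" by simp
    have "real i * q \<le> real n * 1" using i b_le q_nonneg by (intro mult_mono) auto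
    then have "\<bar>(sqnorm p x - real i * m) + real i * q + (dot p b x)\<^sup>2\<bar>
        \<le> \<bar>sqnorm p x - real i * m\<bar> + real n + (dot p b x)\<^sup>2"
      using q_nonneg mult_nonneg_nonneg[OF of_nat_0_le_iff q_nonneg, of i] zero_le_power2[of "dot p b x"] by linarith
    then have "\<gamma>\<^sup>2 * \<bar>(sqnorm p x - real i * m) + real i * q + (dot p b x)\<^sup>2\<bar>
        \<le> \<gamma>\<^sup>2 * (\<bar>sqnorm p x - real i * m\<bar> + real n + (dot p b x)\<^sup>2)"
      by (intro mult_left_mono) auto
    then have 2: "\<bar>\<gamma>\<^sup>2 * ((sqnorm p x - real i * m) + real i * q + (dot p b x)\<^sup>2)\<bar>
        \<le> \<gamma>\<^sup>2 * (\<bar>sqnorm p x - real i * m\<bar> + real n + (dot p b x)\<^sup>2)"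
      by (simp add: abs_mult)
    show ?thesis
      unfolding Q_C_minus_v using 1 2 by (meson abs_triangle_ineq add_mono order_trans)
  qed
  have "(\<integral>\<omega>. \<bar>Q (C (P i \<omega>)) - v i\<bar> \<partial>M)
      \<le> (\<integral>\<omega>. 4 * (\<alpha> * \<gamma>) * \<bar>dot p b (P i \<omega>)\<bar>
        + \<gamma>\<^sup>2 * (\<bar>D i \<omega>\<bar> + real n + (dot p b (P i \<omega>))\<^sup>2) \<partial>M)"
    using int integrable_Q_C[OF i'] by (intro integral_mono pt) auto
  also have "\<dots> = 4 * (\<alpha> * \<gamma>) * (\<integral>\<omega>. \<bar>dot p b (P i \<omega>)\<bar> \<partial>M)
      + \<gamma>\<^sup>2 * ((\<integral>\<omega>. \<bar>D i \<omega>\<bar> \<partial>M) + real n + (\<integral>\<omega>. (dot p b (P i \<omega>))\<^sup>2 \<partial>M))"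
    using int by (simp add: prob_space)
  also have "\<dots> \<le> 4 * (\<alpha> * \<gamma>) * sqrt (real n * (2 * q))
      + \<gamma>\<^sup>2 * (sqrt (real n * (2 * K * (real p)\<^sup>2 + 32 * real n * real p)) + real n + real n * (2 * q))"
    using alpha_nonneg gamma_nonneg by (intro add_mono mult_left_mono Eb ED Eb2) auto
  also have "\<dots> \<le> 4 * (4 / (real n * sqrt (real p)))
      + (8 / (real n * real n * real p)) * (real n * real p * sqrt (2 * K / real n + 32 / real p) + 3 * real n)"
  proof (rule add_mono, rule_tac [2] mult_mono)
    \<comment> \<open>Squaring exposes \<alpha>^2 q and \<gamma>^2 p, the two products that the
      locale bounds.\<close>
    have "(\<alpha> * \<gamma> * sqrt (real n * (2 * q)))\<^sup>2 = (\<alpha>\<^sup>2 * q) * (\<gamma>\<^sup>2 * real p) * (2 * real n / real p)"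
      using q_nonneg p0 by (simp add: power_mult_distrib)
    also have "\<dots> \<le> (1 / real n) * (8 / (real n)\<^sup>2) * (2 * real n / real p)"
      by (intro mult_mono alpha_le gamma_le) auto
    also have "\<dots> = (4 / (real n * sqrt (real p)))\<^sup>2"
      using n0 p0 by (simp add: power_divide power_mult_distrib field_simps power2_eq_square)
    finally have "\<alpha> * \<gamma> * sqrt (real n * (2 * q)) \<le> 4 / (real n * sqrt (real p))"
      by (rule power2_le_imp_le) simp
    then show "4 * (\<alpha> * \<gamma>) * sqrt (real n * (2 * q)) \<le> 4 * (4 / (real n * sqrt (real p)))" by simp
    show "\<gamma>\<^sup>2 \<le> 8 / (real n * real n * real p)"
      using gamma_le p0 n0 by (simp add: field_simps power2_eq_square)
    have "real n * (2 * K * (real p)\<^sup>2 + 32 * real n * real p)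
        = (real n * real p)\<^sup>2 * (2 * K / real n + 32 / real p)"
      using n0 p0 by (simp add: field_simps power2_eq_square)
    then show "sqrt (real n * (2 * K * (real p)\<^sup>2 + 32 * real n * real p)) + real n + real n * (2 * q)
        \<le> real n * real p * sqrt (2 * K / real n + 32 / real p) + 3 * real n"
      using b_le n0 p0 by (simp add: real_sqrt_mult)
  qed (use n0 p0 K q_nonneg in auto)
  also have "\<dots> = G / real n"
    using n0 p0 by (simp add: variance_error_def field_simps)
  finally show ?thesis .
qed

lemma sqnorm_C_square_le:
  "(sqnorm p (C x))\<^sup>2 \<le> 8 * (\<alpha>\<^sup>2 * q)\<^sup>2 + 8 * (\<gamma>\<^sup>2)\<^sup>2 * (sqnorm p x)\<^sup>2"
proof -
  have "sqnorm p (C x) \<le> 2 * (\<alpha>\<^sup>2 * q) + 2 * (\<gamma>\<^sup>2 * sqnorm p x)"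
    using sqnorm_add_le[of p "\<lambda>j. \<alpha> * b j" "\<lambda>j. \<gamma> * x j"] by (simp add: sqnorm_scale)
  then have "(sqnorm p (C x))\<^sup>2 \<le> (2 * (\<alpha>\<^sup>2 * q) + 2 * (\<gamma>\<^sup>2 * sqnorm p x))\<^sup>2"
    by (intro power_mono sqnorm_nonneg)
  also have "\<dots> \<le> 2 * (2 * (\<alpha>\<^sup>2 * q))\<^sup>2 + 2 * (2 * (\<gamma>\<^sup>2 * sqnorm p x))\<^sup>2"
    by (rule square_sum_le)
  finally show ?thesis by (simp add: power_mult_distrib)
qed

lemma integrable_C4: "i \<le> n \<Longrightarrow> integrable M (\<lambda>\<omega>. (sqnorm p (C (P i \<omega>)))\<^sup>2)"
  by (rule integrable_dominated_P[of i _ "8 * (\<alpha>\<^sup>2 * q)\<^sup>2" "8 * (\<gamma>\<^sup>2)\<^sup>2"])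
    (simp_all only: abs_of_nonneg[OF zero_le_power2] sqnorm_C_square_le, measurable)

lemma E_C4:
  assumes i: "i < n"
  shows "(\<integral>\<omega>. (sqnorm p (C (P i \<omega>)))\<^sup>2 \<partial>M) \<le> L / (real n)\<^sup>2"
proof -
  have n0: "0 < real n" and i': "i \<le> n" using i by auto
  have p0: "0 < real p" using p_pos by simp
  note K = K_ge_1[OF i]
  have "(\<integral>\<omega>. (sqnorm p (C (P i \<omega>)))\<^sup>2 \<partial>M)
      \<le> (\<integral>\<omega>. 8 * (\<alpha>\<^sup>2 * q)\<^sup>2 + 8 * (\<gamma>\<^sup>2)\<^sup>2 * (sqnorm p (P i \<omega>))\<^sup>2 \<partial>M)"
    using integrable_C4[OF i'] integrable_P4[OF i'] by (intro integral_mono sqnorm_C_square_le) auto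
  also have "\<dots> = 8 * (\<alpha>\<^sup>2 * q)\<^sup>2 + 8 * (\<gamma>\<^sup>2)\<^sup>2 * (\<integral>\<omega>. (sqnorm p (P i \<omega>))\<^sup>2 \<partial>M)"
    using integrable_P4[OF i'] by (simp add: prob_space)
  also have "\<dots> \<le> 8 * (\<alpha>\<^sup>2 * q)\<^sup>2 + 8 * (\<gamma>\<^sup>2)\<^sup>2 * ((4 * K + 72) * (real n)\<^sup>2 * (real p)\<^sup>2)"
    by (intro add_mono mult_left_mono E_P4 i') auto
  also have "\<dots> = 8 * (\<alpha>\<^sup>2 * q)\<^sup>2 + 8 * (\<gamma>\<^sup>2 * real p)\<^sup>2 * ((4 * K + 72) * (real n)\<^sup>2)"
    by (simp add: power_mult_distrib algebra_simps)
  also have "\<dots> \<le> 8 * (1 / real n)\<^sup>2 + 8 * (8 / (real n)\<^sup>2)\<^sup>2 * ((4 * K + 72) * (real n)\<^sup>2)"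
    using K q_nonneg by (intro add_mono mult_left_mono mult_right_mono power_mono alpha_le gamma_le) auto
  also have "\<dots> = L / (real n)\<^sup>2"
    using n0 by (simp add: fourth_moment_const_def field_simps power2_eq_square)
  finally show ?thesis .
qed

text \<open>With the past frozen at x, the increment is centred with variance Q (C x), so the
  third-order expansion \<open>char_approx3'\<close> applies. Passing from Q (C x) to
  \<open>v i\<close> costs the first term.\<close>

lemma char_step_fixed_past:
  assumes i: "i < n" and \<delta>: "0 < \<delta>"
  shows "cmod ((\<integral>\<omega>. iexp (t * dot p (C x) (V i \<omega>)) \<partial>M) - (1 - t\<^sup>2 * v i / 2))
    \<le> t\<^sup>2 / 2 * \<bar>Q (C x) - v i\<bar> + \<bar>t\<bar>^3 / 12 * (\<delta> * Q (C x) + K * (sqnorm p (C x))\<^sup>2 / \<delta>)"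
proof -
  let ?X = "\<lambda>\<omega>. dot p (C x) (V i \<omega>)"
  have [measurable]: "?X \<in> borel_measurable M" using i by measurable
  note int = integrable_dot[OF i, of "C x"] integrable_dot2[OF i, of "C x"] integrable_dot4[OF i, of "C x"]
  have char: "(\<integral>\<omega>. iexp (t * ?X \<omega>) \<partial>M) = char (distr M borel ?X) t"
    unfolding char_def by (subst integral_distr) auto
  have "cmod ((\<integral>\<omega>. iexp (t * ?X \<omega>) \<partial>M) - (1 - t\<^sup>2 * Q (C x) / 2))
      \<le> t\<^sup>2 / 6 * (\<integral>\<omega>. min (6 * (?X \<omega>)\<^sup>2) (\<bar>t\<bar> * \<bar>?X \<omega>\<bar>^3) \<partial>M)"
    unfolding char by (rule char_approx3') (use int in \<open>simp_all add: E_dot[OF i] E_dot2[OF i]\<close>)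
  \<comment> \<open>The minimum is bounded by its cubic branch, which \<open>abs_cube_le\<close>
    then splits.\<close>
  also have "\<dots> \<le> t\<^sup>2 / 6 * (\<integral>\<omega>. \<bar>t\<bar> * ((\<delta> * (?X \<omega>)\<^sup>2 + (?X \<omega>)^4 / \<delta>) / 2) \<partial>M)"
  proof (intro mult_left_mono integral_mono')
    show "integrable M (\<lambda>\<omega>. \<bar>t\<bar> * ((\<delta> * (?X \<omega>)\<^sup>2 + (?X \<omega>)^4 / \<delta>) / 2))"
      using int by simp
    show "min (6 * (?X \<omega>)\<^sup>2) (\<bar>t\<bar> * \<bar>?X \<omega>\<bar>^3) \<le> \<bar>t\<bar> * ((\<delta> * (?X \<omega>)\<^sup>2 + (?X \<omega>)^4 / \<delta>) / 2)" for \<omega>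
      by (intro min.coboundedI2 mult_left_mono abs_cube_le \<delta>) auto
    show "0 \<le> \<bar>t\<bar> * ((\<delta> * (?X \<omega>)\<^sup>2 + (?X \<omega>)^4 / \<delta>) / 2)" for \<omega>
      using \<delta> by simp
  qed auto
  also have "\<dots> = \<bar>t\<bar>^3 / 12 * (\<delta> * Q (C x) + (\<integral>\<omega>. (?X \<omega>)^4 \<partial>M) / \<delta>)"
  proof -
    have "\<bar>t\<bar>^3 = t\<^sup>2 * \<bar>t\<bar>" by (simp add: power2_eq_square power3_eq_cube)
    then show ?thesis using int by (simp add: E_dot2[OF i] algebra_simps add_divide_distrib)
  qed
  also have "\<dots> \<le> \<bar>t\<bar>^3 / 12 * (\<delta> * Q (C x) + K * (sqnorm p (C x))\<^sup>2 / \<delta>)"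
    using \<delta> by (intro mult_left_mono add_left_mono divide_right_mono E_dot4 i) auto
  finally have 1: "cmod ((\<integral>\<omega>. iexp (t * ?X \<omega>) \<partial>M) - (1 - t\<^sup>2 * Q (C x) / 2))
      \<le> \<bar>t\<bar>^3 / 12 * (\<delta> * Q (C x) + K * (sqnorm p (C x))\<^sup>2 / \<delta>)" .
  have "complex_of_real (1 - t\<^sup>2 * Q (C x) / 2) - complex_of_real (1 - t\<^sup>2 * v i / 2)
      = complex_of_real (- (t\<^sup>2 / 2) * (Q (C x) - v i))"
    unfolding of_real_diff[symmetric] by (rule arg_cong[where f=complex_of_real]) (simp add: field_simps)
  then have 2: "cmod (complex_of_real (1 - t\<^sup>2 * Q (C x) / 2) - complex_of_real (1 - t\<^sup>2 * v i / 2))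
      = t\<^sup>2 / 2 * \<bar>Q (C x) - v i\<bar>"
    by (simp only: norm_of_real abs_mult abs_minus_cancel) simp
  have tri: "cmod (z - y) \<le> a + c" if "cmod (z - w) \<le> c" "cmod (w - y) = a" for z y w a c
    using norm_triangle_ineq[of "z - w" "w - y"] that by simp
  show ?thesis
    by (rule tri[OF _ 2]) (use 1 in simp)
qed

definition \<phi> :: "real \<Rightarrow> nat \<Rightarrow> complex" where
  "\<phi> t i = (\<integral>\<omega>. iexp (t * S i \<omega>) \<partial>M)"

lemma cmod_phi_le: "cmod (\<phi> t i) \<le> 1"
\<comment> \<open>For i > n nothing makes \<open>S i\<close> measurable; a non-integrable function
  has integral 0 by default, so the bound survives.\<close>
proof (cases "integrable M (\<lambda>\<omega>. iexp (t * S i \<omega>))")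
  case True
  have "cmod (\<phi> t i) \<le> (\<integral>\<omega>. cmod (iexp (t * S i \<omega>)) \<partial>M)"
    unfolding \<phi>_def by (rule integral_norm_bound)
  then show ?thesis by (simp add: prob_space)
qed (simp add: \<phi>_def not_integrable_integral_eq)

lemma integrable_unimodular:
  fixes f :: "'a \<Rightarrow> real"
  assumes [measurable]: "f \<in> borel_measurable M"
  shows "integrable M (\<lambda>\<omega>. iexp (f \<omega>))"
  by (rule integrable_const_bound[where B=1]) auto

lemma char_step:
  assumes i: "i < n"
  shows "cmod (\<phi> t (Suc i) - (1 - t\<^sup>2 * v i / 2) * \<phi> t i)
    \<le> (t\<^sup>2 / 2 * G + \<bar>t\<bar>^3 / 12 * ((10 + G + K * L) / sqrt (real n))) / real n"
proof -
  have n0: "0 < real n" and n1: "1 \<le> n" and i': "i \<le> n" using i by auto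
  have p0: "0 < real p" using p_pos by simp
  note K = K_ge_1[OF i]
  \<comment> \<open>This balances \<delta> * E Q, of order \<delta> / n, against E|C|^4 / \<delta>,
    of order 1 / (\<delta> n^2): both become n^(-3/2).\<close>
  define \<delta> where "\<delta> = 1 / sqrt (real n)"
  have \<delta>: "0 < \<delta>" using n0 by (simp add: \<delta>_def)
  let ?g = "\<lambda>x. \<integral>\<omega>. iexp (t * dot p (C x) (V i \<omega>)) \<partial>M"
  let ?a = "1 - complex_of_real (t\<^sup>2 * v i / 2)"
  let ?B = "\<lambda>\<omega>. t\<^sup>2 / 2 * \<bar>Q (C (P i \<omega>)) - v i\<bar>
    + \<bar>t\<bar>^3 / 12 * (\<delta> * Q (C (P i \<omega>)) + K * (sqnorm p (C (P i \<omega>)))\<^sup>2 / \<delta>)"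
  let ?f = "\<lambda>z. iexp (t * snd (fst z)) * iexp (t * dot p (C (fst (fst z))) (snd z))"
  have f: "?f \<in> borel_measurable ((Rvec p \<Otimes>\<^sub>M borel) \<Otimes>\<^sub>M Rvec p)"
    by measurable
  have [measurable]: "S i \<in> borel_measurable M" using i' by (rule rv_S)
  have "integrable M (\<lambda>\<omega>. ?f ((P i \<omega>, S i \<omega>), V i \<omega>))"
    by (rule integrable_const_bound[where B=1]) (use i in \<open>auto simp: norm_mult\<close>)
  note it = integral_past[OF i f this, simplified fst_conv snd_conv integral_mult_right_zero]
  have phi: "\<phi> t (Suc i) = (\<integral>\<omega>. iexp (t * S i \<omega>) * ?g (P i \<omega>) \<partial>M)"
    unfolding it(2)[symmetric] \<phi>_def S_Suc by (simp add: distrib_left exp_add)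
  have iS: "integrable M (\<lambda>\<omega>. iexp (t * S i \<omega>))"
    by (rule integrable_unimodular) measurable
  have "\<phi> t (Suc i) - ?a * \<phi> t i = (\<integral>\<omega>. iexp (t * S i \<omega>) * ?g (P i \<omega>) - ?a * iexp (t * S i \<omega>) \<partial>M)"
    unfolding phi unfolding \<phi>_def
    by (subst Bochner_Integration.integral_diff[OF it(1)])
      (use iS in \<open>simp_all only: integrable_mult_right integral_mult_right_zero\<close>)
  also have "\<dots> = (\<integral>\<omega>. iexp (t * S i \<omega>) * (?g (P i \<omega>) - ?a) \<partial>M)"
    by (rule Bochner_Integration.integral_cong) (simp_all add: algebra_simps)
  finally have diff: "\<phi> t (Suc i) - ?a * \<phi> t i = (\<integral>\<omega>. iexp (t * S i \<omega>) * (?g (P i \<omega>) - ?a) \<partial>M)" .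
  have "cmod (\<phi> t (Suc i) - ?a * \<phi> t i)
      \<le> (\<integral>\<omega>. cmod (iexp (t * S i \<omega>) * (?g (P i \<omega>) - ?a)) \<partial>M)"
    unfolding diff by (rule integral_norm_bound)
  also have "\<dots> \<le> (\<integral>\<omega>. ?B \<omega> \<partial>M)"
  proof (rule integral_mono')
    show "integrable M ?B"
      using integrable_Q_C[OF i'] integrable_C4[OF i'] by simp
    show "cmod (iexp (t * S i \<omega>) * (?g (P i \<omega>) - ?a)) \<le> ?B \<omega>" for \<omega>
      using char_step_fixed_past[OF i \<delta>, of t "P i \<omega>"] by (simp add: norm_mult)
    show "0 \<le> ?B \<omega>" for \<omega>
      using \<delta> K by (intro add_nonneg_nonneg mult_nonneg_nonneg divide_nonneg_nonneg) (auto simp: Q_nonneg sqnorm_nonneg)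
  qed
  finally have le_B: "cmod (\<phi> t (Suc i) - ?a * \<phi> t i) \<le> (\<integral>\<omega>. ?B \<omega> \<partial>M)" .
  have lin: "(\<integral>\<omega>. c1 * \<bar>f \<omega> - v i\<bar> + c2 * (\<delta> * f \<omega> + K * h \<omega> / \<delta>) \<partial>M)
      = c1 * (\<integral>\<omega>. \<bar>f \<omega> - v i\<bar> \<partial>M) + c2 * (\<delta> * (\<integral>\<omega>. f \<omega> \<partial>M) + K * (\<integral>\<omega>. h \<omega> \<partial>M) / \<delta>)"
    if "integrable M f" "integrable M h" for f h :: "'a \<Rightarrow> real" and c1 c2
    using that by simp
  have "(\<integral>\<omega>. ?B \<omega> \<partial>M) = t\<^sup>2 / 2 * (\<integral>\<omega>. \<bar>Q (C (P i \<omega>)) - v i\<bar> \<partial>M)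
    + \<bar>t\<bar>^3 / 12 * (\<delta> * (\<integral>\<omega>. Q (C (P i \<omega>)) \<partial>M) + K * (\<integral>\<omega>. (sqnorm p (C (P i \<omega>)))\<^sup>2 \<partial>M) / \<delta>)"
    using integrable_Q_C[OF i'] integrable_C4[OF i'] by (simp only: lin)
  also have "\<dots> \<le> t\<^sup>2 / 2 * (G / real n)
    + \<bar>t\<bar>^3 / 12 * (\<delta> * ((10 + G) / real n) + K * (L / (real n)\<^sup>2) / \<delta>)"
  proof (intro add_mono mult_left_mono divide_right_mono E_abs_Q_C_minus_v E_C4 i)
    have "(\<integral>\<omega>. Q (C (P i \<omega>)) \<partial>M) \<le> (\<integral>\<omega>. \<bar>Q (C (P i \<omega>)) - v i\<bar> + v i \<partial>M)"
      using integrable_Q_C[OF i'] by (intro integral_mono) auto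
    also have "\<dots> = (\<integral>\<omega>. \<bar>Q (C (P i \<omega>)) - v i\<bar> \<partial>M) + v i"
      using integrable_Q_C[OF i'] by (subst Bochner_Integration.integral_add) (auto simp: prob_space)
    also have "\<dots> \<le> G / real n + 10 / real n"
      by (intro add_mono E_abs_Q_C_minus_v v_le i)
    finally show "(\<integral>\<omega>. Q (C (P i \<omega>)) \<partial>M) \<le> (10 + G) / real n" by (simp add: add_divide_distrib)
  qed (use \<delta> K in auto)
  also have "\<dots> = (t\<^sup>2 / 2 * G + \<bar>t\<bar>^3 / 12 * ((10 + G + K * L) / sqrt (real n))) / real n"
  proof -
    define r where "r = sqrt (real n)"
    have r: "0 < r" "real n = r * r" using n0 by (auto simp: r_def)
    show ?thesis unfolding \<delta>_def r_def[symmetric] r(2) using r(1)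
      by (simp add: field_simps power2_eq_square)
  qed
  finally have "(\<integral>\<omega>. ?B \<omega> \<partial>M)
      \<le> (t\<^sup>2 / 2 * G + \<bar>t\<bar>^3 / 12 * ((10 + G + K * L) / sqrt (real n))) / real n" .
  from order_trans[OF le_B this] show ?thesis by simp
qed

lemma char_S_bound:
  assumes n: "1 \<le> n" and sum_v: "\<bar>(\<Sum>i<n. v i) - 1\<bar> \<le> 1 / (real n - 1)"
  shows "cmod (char (distr M borel (S n)) t - char std_normal_distribution t)
    \<le> char_error K n p t"
proof -
  have n0: "0 < real n" using n by simp
  let ?E = "(t\<^sup>2 / 2 * G + \<bar>t\<bar>^3 / 12 * ((10 + G + K * L) / sqrt (real n))) / real n"
  let ?e = "\<lambda>i. complex_of_real (exp (- (t\<^sup>2 / 2 * (\<Sum>k<i. v k))))"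
  \<comment> \<open>From y <= 5 t^2 / n, which is \<open>v_le\<close> with y = t^2 v_i / 2, this
    dominates y^2 / 2.\<close>
  let ?F = "25 * t^4 / (2 * (real n)\<^sup>2)"
  have "cmod (\<phi> t i - ?e i) \<le> real i * (?E + ?F)" if "i \<le> n" for i
    using that
  proof (induction i)
    case 0
    then show ?case by (simp add: \<phi>_def prob_space)
  next
    case (Suc i)
    then have i: "i < n" by simp
    define y where "y = t\<^sup>2 * v i / 2"
    have y0: "0 \<le> y" by (simp add: y_def v_nonneg)
    have "y \<le> t\<^sup>2 * (10 / real n) / 2"
      unfolding y_def by (intro divide_right_mono mult_left_mono v_le i) auto
    then have "y\<^sup>2 / 2 \<le> (t\<^sup>2 * (10 / real n) / 2)\<^sup>2 / 2"
      using y0 by (intro divide_right_mono power_mono) auto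
    also have "\<dots> = ?F"
      using n0 by (simp add: field_simps power2_eq_square power4_eq_xxxx)
    finally have y2: "y\<^sup>2 / 2 \<le> ?F" .
    have e: "?e (Suc i) = complex_of_real (exp (- y)) * ?e i"
      by (simp add: y_def algebra_simps flip: exp_add of_real_mult)
    \<comment> \<open>One-step error, then linear factor against exponential, then the inherited
      error. The last is multiplied by exp (- y) <= 1 and so does not grow.\<close>
    have split: "\<phi> t (Suc i) - ?e (Suc i) = (\<phi> t (Suc i) - (1 - complex_of_real y) * \<phi> t i)
        + complex_of_real ((1 - y) - exp (- y)) * \<phi> t i + complex_of_real (exp (- y)) * (\<phi> t i - ?e i)"
      unfolding e by (simp add: algebra_simps)
    have "cmod (\<phi> t (Suc i) - ?e (Suc i)) \<le> cmod (\<phi> t (Suc i) - (1 - complex_of_real y) * \<phi> t i)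
        + cmod (complex_of_real ((1 - y) - exp (- y)) * \<phi> t i)
        + cmod (complex_of_real (exp (- y)) * (\<phi> t i - ?e i))"
      unfolding split by (intro order_trans[OF norm_triangle_ineq] add_mono order_refl norm_triangle_ineq)
    also have "\<dots> \<le> ?E + ?F * 1 + 1 * (real i * (?E + ?F))"
    proof (intro add_mono)
      show "cmod (\<phi> t (Suc i) - (1 - complex_of_real y) * \<phi> t i) \<le> ?E"
        using char_step[OF i, of t] by (simp add: y_def)
      have "\<bar>(1 - y) - exp (- y)\<bar> \<le> ?F" using exp_minus_bound[OF y0] y2 by linarith
      then show "cmod (complex_of_real ((1 - y) - exp (- y)) * \<phi> t i) \<le> ?F * 1"
        unfolding norm_mult norm_of_real by (intro mult_mono cmod_phi_le) auto
      show "cmod (complex_of_real (exp (- y)) * (\<phi> t i - ?e i)) \<le> 1 * (real i * (?E + ?F))"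
        unfolding norm_mult norm_of_real using y0 Suc.IH i by (intro mult_mono) auto
    qed
    also have "\<dots> = real (Suc i) * (?E + ?F)"
    proof -
      have "e + f * 1 + 1 * (r * (e + f)) = (1 + r) * (e + f)" for e f r :: real
        by (simp add: algebra_simps)
      then show ?thesis by (simp only: of_nat_Suc)
    qed
    finally show ?case .
  qed
  from this[of n] have 1: "cmod (\<phi> t n - ?e n) \<le> real n * (?E + ?F)" by simp
  have eq: "real n * (?E + ?F) = t\<^sup>2 / 2 * G + \<bar>t\<bar>^3 / 12 * ((10 + G + K * L) / sqrt (real n)) + 25 * t^4 / (2 * real n)"
  proof -
    have "real n * (x / real n + z / (2 * (real n)\<^sup>2)) = x + z / (2 * real n)" for x z
      using n0 by (simp add: field_simps power2_eq_square)
    then show ?thesis .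
  qed
  have "cmod (?e n - complex_of_real (exp (- (t\<^sup>2 / 2)))) = \<bar>exp (- (t\<^sup>2 / 2 * (\<Sum>k<n. v k))) - exp (- (t\<^sup>2 / 2))\<bar>"
    by (simp only: norm_of_real flip: of_real_diff)
  also have "\<dots> \<le> \<bar>t\<^sup>2 / 2 * (\<Sum>k<n. v k) - t\<^sup>2 / 2\<bar>"
    by (intro exp_minus_diff_le mult_nonneg_nonneg sum_nonneg v_nonneg) auto
  also have "\<dots> = t\<^sup>2 / 2 * \<bar>(\<Sum>k<n. v k) - 1\<bar>"
  proof -
    have "t\<^sup>2 / 2 * (\<Sum>k<n. v k) - t\<^sup>2 / 2 = t\<^sup>2 / 2 * ((\<Sum>k<n. v k) - 1)" by (simp add: algebra_simps)
    then show ?thesis by (simp only: abs_mult) simp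
  qed
  also have "\<dots> \<le> t\<^sup>2 / 2 * (1 / (real n - 1))" by (intro mult_left_mono sum_v) auto
  finally have 2: "cmod (?e n - complex_of_real (exp (- (t\<^sup>2 / 2)))) \<le> t\<^sup>2 / 2 * (1 / (real n - 1))" .
  have "char (distr M borel (S n)) t = \<phi> t n"
    unfolding char_def \<phi>_def by (subst integral_distr) auto
  moreover have "char std_normal_distribution t = complex_of_real (exp (- (t\<^sup>2 / 2)))"
    by (simp add: char_std_normal_distribution)
  ultimately show ?thesis
    using 1 2 norm_triangle_ineq[of "\<phi> t n - ?e n" "?e n - complex_of_real (exp (- (t\<^sup>2 / 2)))"]
    unfolding eq char_error_def by simp
qed

end

section \<open>Gaussian moments of one observation\<close>

lemma sets_std_normal_vec: "sets (std_normal_vec p) = sets (Rvec p)"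
  unfolding std_normal_vec_def by (rule sets_PiM_cong) auto

lemma prob_space_std_normal_vec: "prob_space (std_normal_vec p)"
  unfolding std_normal_vec_def
  using real_dist_normal_dist by (intro prob_space_PiM) (simp add: real_distribution_def)

lemma char_distr_cmult:
  assumes [measurable]: "f \<in> borel_measurable M"
  shows "char (distr M borel (\<lambda>x. a * f x)) t = char (distr M borel f) (a * t)"
  unfolding char_def by (simp add: integral_distr ac_simps)

text \<open>Under the product measure the coordinates are independent standard normals, so the
  characteristic function factorises.\<close>

lemma char_std_normal_vec_dot:
  "char (distr (std_normal_vec p) borel (dot p u)) t = exp (- (t\<^sup>2 * sqnorm p u) / 2)"
proof (cases "p = 0")
  case True
  have "dot p u = (\<lambda>_. 0)" using True by (simp add: dot_def fun_eq_iff)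
  then show ?thesis using True by (simp add: char_def sqnorm_def integral_distr
      prob_space_std_normal_vec[THEN prob_space.prob_space])
next
  case False
  define N where "N = std_normal_vec p"
  interpret N: prob_space N unfolding N_def by (rule prob_space_std_normal_vec)
  have sN [measurable_cong]: "sets N = sets (Rvec p)" unfolding N_def by (rule sets_std_normal_vec)
  have coord: "distr N borel (\<lambda>x. x j) = std_normal_distribution" if "j < p" for j
  proof -
    have "distr (Pi\<^sub>M {..<p} (\<lambda>_. std_normal_distribution)) std_normal_distribution (\<lambda>x. x j)
        = std_normal_distribution"
      using real_dist_normal_dist that
      by (intro distr_PiM_component) (auto simp: real_distribution_def)
    then show ?thesis
      unfolding N_def std_normal_vec_def by (subst distr_cong[OF refl _ refl, of borel std_normal_distribution]) auto
  qed
  have "N.indep_vars (\<lambda>_. borel) (\<lambda>j x. x j) {..<p}"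
  proof (subst N.indep_vars_iff_distr_eq_PiM')
    \<comment> \<open>The product criterion for independence needs a nonempty index set, hence the
      separate case p = 0.\<close>
    show "{..<p} \<noteq> {}" using False by auto
    have "distr N (Rvec p) (\<lambda>x. \<lambda>j\<in>{..<p}. x j) = distr N N (\<lambda>x. x)"
      by (rule distr_cong) (auto simp: sN sets_eq_imp_space_eq[OF sN] space_PiM PiE_def extensional_restrict)
    also have "\<dots> = N" by simp
    also have "N = (\<Pi>\<^sub>M j\<in>{..<p}. distr N borel (\<lambda>x. x j))"
      unfolding N_def[unfolded std_normal_vec_def] by (rule PiM_cong) (auto simp: coord[unfolded N_def std_normal_vec_def])
    finally show "distr N (Rvec p) (\<lambda>x. \<lambda>j\<in>{..<p}. x j) = (\<Pi>\<^sub>M j\<in>{..<p}. distr N borel (\<lambda>x. x j))" .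
  qed simp
  then have "N.indep_vars (\<lambda>_. borel) (\<lambda>j x. u j * x j) {..<p}"
    by (rule N.indep_vars_compose2) simp
  then have "char (distr N borel (\<lambda>x. \<Sum>j<p. u j * x j)) t = (\<Prod>j<p. char (distr N borel (\<lambda>x. u j * x j)) t)"
    by (rule N.char_distr_sum)
  also have "\<dots> = (\<Prod>j<p. complex_of_real (exp (- ((u j * t)\<^sup>2) / 2)))"
    by (intro prod.cong refl)
      (simp add: char_distr_cmult coord char_std_normal_distribution)
  also have "\<dots> = complex_of_real (exp (\<Sum>j<p. - ((u j * t)\<^sup>2) / 2))"
    by (simp only: exp_sum finite_lessThan of_real_prod)
  also have "(\<Sum>j<p. - ((u j * t)\<^sup>2) / 2) = - (t\<^sup>2 * sqnorm p u) / 2"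
    by (simp add: sqnorm_def sum_distrib_left sum_divide_distrib sum_negf power_mult_distrib mult.commute)
  finally show ?thesis by (simp add: N_def dot_def[abs_def])
qed

text \<open>Comparing characteristic functions also covers |u| = 0, where the law has no
  density.\<close>

lemma distr_std_normal_vec_dot:
  "distr (std_normal_vec p) borel (dot p u) = distr std_normal_distribution borel (\<lambda>z. sqrt (sqnorm p u) * z)"
proof (rule Levy_uniqueness)
  interpret N: prob_space "std_normal_vec p" by (rule prob_space_std_normal_vec)
  interpret Z: real_distribution std_normal_distribution by (rule real_dist_normal_dist)
  have [measurable]: "dot p u \<in> borel_measurable (std_normal_vec p)"
    unfolding measurable_cong_sets[OF sets_std_normal_vec refl] by measurable
  show "real_distribution (distr (std_normal_vec p) borel (dot p u))"
    by (rule N.real_distribution_distr) measurable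
  show "real_distribution (distr std_normal_distribution borel (\<lambda>z. sqrt (sqnorm p u) * z))"
    by (rule Z.real_distribution_distr) measurable
  show "char (distr (std_normal_vec p) borel (dot p u))
      = char (distr std_normal_distribution borel (\<lambda>z. sqrt (sqnorm p u) * z))"
  proof
    fix t
    have "char (distr std_normal_distribution borel (\<lambda>z. sqrt (sqnorm p u) * z)) t
        = char std_normal_distribution (sqrt (sqnorm p u) * t)"
      by (subst char_distr_cmult) (simp_all add: distr_id2)
    also have "\<dots> = exp (- (t\<^sup>2 * sqnorm p u) / 2)"
      by (simp add: char_std_normal_distribution power_mult_distrib sqnorm_nonneg mult.commute)
    finally show "char (distr (std_normal_vec p) borel (dot p u)) t
        = char (distr std_normal_distribution borel (\<lambda>z. sqrt (sqnorm p u) * z)) t"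
      by (simp only: char_std_normal_vec_dot)
  qed
qed

text \<open>The factor is (2k - 1)!!, that is 1, 3 and 105 for k = 1, 2 and 4.\<close>

lemma std_normal_vec_dot_moment:
  assumes X [measurable]: "X \<in> measurable M (Rvec p)" and distr: "distr M (Rvec p) X = std_normal_vec p"
  shows "integrable M (\<lambda>\<omega>. (dot p u (X \<omega>))^(2 * k))"
    and "(\<integral>\<omega>. (dot p u (X \<omega>))^(2 * k) \<partial>M) = (sqnorm p u)^k * (fact (2 * k) / (2^k * fact k))"
proof -
  let ?s = "sqrt (sqnorm p u)"
  have "distr M borel (\<lambda>\<omega>. dot p u (X \<omega>)) = distr (distr M (Rvec p) X) borel (dot p u)"
    by (subst distr_distr) (auto simp: comp_def)
  also have "\<dots> = distr std_normal_distribution borel (\<lambda>z. ?s * z)"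
    unfolding distr by (rule distr_std_normal_vec_dot)
  finally have eq: "distr M borel (\<lambda>\<omega>. dot p u (X \<omega>)) = distr std_normal_distribution borel (\<lambda>z. ?s * z)" .
  have "integrable M (\<lambda>\<omega>. (dot p u (X \<omega>))^(2 * k)) \<longleftrightarrow>
      integrable (distr M borel (\<lambda>\<omega>. dot p u (X \<omega>))) (\<lambda>x. x^(2 * k))"
    by (subst integrable_distr_eq) auto
  also have "\<dots> \<longleftrightarrow> integrable std_normal_distribution (\<lambda>z. ?s^(2 * k) * z^(2 * k))"
    unfolding eq by (subst integrable_distr_eq) (auto simp: power_mult_distrib)
  finally show "integrable M (\<lambda>\<omega>. (dot p u (X \<omega>))^(2 * k))"
    using std_normal_distribution_even_moments(2)[of k] by (metis integrable_mult_right)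
  have "(\<integral>\<omega>. (dot p u (X \<omega>))^(2 * k) \<partial>M) = (\<integral>x. x^(2 * k) \<partial>distr M borel (\<lambda>\<omega>. dot p u (X \<omega>)))"
    by (subst integral_distr) auto
  also have "\<dots> = (\<integral>z. ?s^(2 * k) * z^(2 * k) \<partial>std_normal_distribution)"
    unfolding eq by (subst integral_distr) (auto simp: power_mult_distrib)
  also have "\<dots> = ?s^(2 * k) * (fact (2 * k) / (2^k * fact k))"
    by (simp only: integral_mult_right_zero std_normal_distribution_even_moments(1))
  also have "?s^(2 * k) = (sqnorm p u)^k"
    by (simp only: power_mult real_sqrt_pow2[OF sqnorm_nonneg])
  finally show "(\<integral>\<omega>. (dot p u (X \<omega>))^(2 * k) \<partial>M) = (sqnorm p u)^k * (fact (2 * k) / (2^k * fact k))" .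
qed

lemma normal_distr_moment:
  assumes [measurable]: "\<epsilon> \<in> borel_measurable M" and distr: "distr M borel \<epsilon> = normal_distr 0 \<sigma>"
    and \<sigma>: "0 \<le> \<sigma>" and k: "0 < k"
  shows "integrable M (\<lambda>\<omega>. (\<epsilon> \<omega>)^(2 * k))"
    and "(\<integral>\<omega>. (\<epsilon> \<omega>)^(2 * k) \<partial>M) = (\<sigma>\<^sup>2)^k * (fact (2 * k) / (2^k * fact k))"
proof -
  have "has_bochner_integral (normal_distr 0 \<sigma>) (\<lambda>x. x^(2 * k)) ((\<sigma>\<^sup>2)^k * (fact (2 * k) / (2^k * fact k)))"
  proof (cases "\<sigma> = 0")
    \<comment> \<open>The law is the point mass at 0, and both sides vanish because k > 0.\<close>
    case True
    have "integrable (return borel (0::real)) (\<lambda>x. x^(2 * k))"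
      by (subst integrable_cong_AE[where g="\<lambda>_. 0"]) (use k in \<open>auto simp: AE_return\<close>)
    then show ?thesis
      using True k by (simp add: normal_distr_def has_bochner_integral_iff integral_return zero_power)
  next
    case False
    have "has_bochner_integral lborel (\<lambda>x. normal_density 0 \<sigma> x * (x - 0)^(2 * k)) (fact (2 * k) / ((2 / \<sigma>\<^sup>2)^k * fact k))"
      by (rule normal_moment_even) (use False \<sigma> in simp)
    then show ?thesis
      using False \<sigma> by (simp add: normal_distr_def has_bochner_integral_density field_simps power_divide)
  qed
  then have "has_bochner_integral (distr M borel \<epsilon>) (\<lambda>x. x^(2 * k)) ((\<sigma>\<^sup>2)^k * (fact (2 * k) / (2^k * fact k)))"
    unfolding distr .
  then show "integrable M (\<lambda>\<omega>. (\<epsilon> \<omega>)^(2 * k))"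
    and "(\<integral>\<omega>. (\<epsilon> \<omega>)^(2 * k) \<partial>M) = (\<sigma>\<^sup>2)^k * (fact (2 * k) / (2^k * fact k))"
    by (simp_all add: has_bochner_integral_iff integrable_distr_eq integral_distr)
qed

text \<open>The defining property of conditional expectation, tested against functions of X. The
  assumptions on the conditional mean and variance of the noise enter the proof in this
  form.\<close>

lemma (in prob_space) integral_mult_cond_exp_const:
  assumes X: "X \<in> measurable M (Rvec p)" and [measurable]: "f \<in> borel_measurable M" "g \<in> borel_measurable (Rvec p)"
    and AE: "AE \<omega> in M. real_cond_exp M (sigma_gen M p X) f \<omega> = c"
    and int: "integrable M (\<lambda>\<omega>. g (X \<omega>) * f \<omega>)"
  shows "(\<integral>\<omega>. g (X \<omega>) * f \<omega> \<partial>M) = c * (\<integral>\<omega>. g (X \<omega>) \<partial>M)"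
proof -
  let ?F = "sigma_gen M p X"
  have X_space: "X \<in> space M \<rightarrow> space (Rvec p)" using X by (auto simp: measurable_def)
  have sub: "subalgebra M ?F"
    unfolding subalgebra_def sigma_gen_def
    using X by (auto simp: sets_vimage_algebra2[OF X_space] intro: measurable_sets)
  interpret F: finite_measure_subalgebra M ?F by standard (rule sub)
  have XF: "X \<in> measurable ?F (Rvec p)"
    unfolding sigma_gen_def by (rule measurable_vimage_algebra1[OF X_space])
  have gF: "(\<lambda>\<omega>. g (X \<omega>)) \<in> borel_measurable ?F"
    by (rule measurable_compose[OF XF]) measurable
  note X[measurable]
  have "(\<integral>\<omega>. g (X \<omega>) * f \<omega> \<partial>M) = (\<integral>\<omega>. g (X \<omega>) * real_cond_exp M ?F f \<omega> \<partial>M)"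
    by (rule F.real_cond_exp_intg(2)[symmetric, OF int gF]) measurable
  also have "\<dots> = (\<integral>\<omega>. c * g (X \<omega>) \<partial>M)"
    by (rule integral_cong_AE) (use AE in \<open>auto\<close>)
  finally show ?thesis by simp
qed

section \<open>Moments of the rescaled regression model\<close>

lemma integrable_mult_of_squares:
  fixes f g :: "'a \<Rightarrow> real"
  assumes [measurable]: "f \<in> borel_measurable M" "g \<in> borel_measurable M"
    and "integrable M (\<lambda>x. (f x)\<^sup>2)" "integrable M (\<lambda>x. (g x)\<^sup>2)"
  shows "integrable M (\<lambda>x. f x * g x)"
proof (rule Bochner_Integration.integrable_bound)
  show "integrable M (\<lambda>x. (f x)\<^sup>2 + (g x)\<^sup>2)" using assms by simp
  have "\<bar>a * c\<bar> \<le> a\<^sup>2 + c\<^sup>2" for a c :: real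
    using sum_squares_bound[of a c] sum_squares_bound[of a "- c"] sum_squares_ge_zero[of a c]
    by (simp add: abs_if power2_eq_square)
  then show "AE x in M. norm (f x * g x) \<le> norm ((f x)\<^sup>2 + (g x)\<^sup>2)" by simp
qed measurable

text \<open>Cauchy-Schwarz against the constant 1, applied twice; it reduces E|X|^8 to eighth
  moments of the coordinates.\<close>

lemma sqnorm_fourth_power_le: "(sqnorm p x)^4 \<le> (real p)^3 * (\<Sum>j<p. (x j)^8)"
proof -
  have CS: "(\<Sum>j<p. f j)\<^sup>2 \<le> real p * (\<Sum>j<p. (f j)\<^sup>2)" for f :: "nat \<Rightarrow> real"
    using Cauchy_Schwarz_ineq_sum[of "\<lambda>_. 1" f "{..<p}"] by simp
  have "(sqnorm p x)^4 = ((\<Sum>j<p. (x j)\<^sup>2)\<^sup>2)\<^sup>2" by (simp add: sqnorm_def)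
  also have "\<dots> \<le> (real p * (\<Sum>j<p. ((x j)\<^sup>2)\<^sup>2))\<^sup>2"
    by (intro power_mono CS) simp
  also have "\<dots> = (real p)\<^sup>2 * (\<Sum>j<p. (x j)^4)\<^sup>2" by (simp add: power_mult_distrib)
  also have "\<dots> \<le> (real p)\<^sup>2 * (real p * (\<Sum>j<p. ((x j)^4)\<^sup>2))"
    by (intro mult_left_mono CS) simp
  finally show ?thesis by (simp add: power2_eq_square power3_eq_cube mult.assoc)
qed

text \<open>The response and X are dependent, so their product is decoupled by a weighted mean
  inequality at the price of eighth moments. The weight \<kappa> absorbs the different sizes of the
  factors.\<close>

lemma fourth_powers_le:
  fixes x y \<kappa> :: real
  assumes "0 < \<kappa>"
  shows "x^4 * y^4 \<le> (\<kappa> * x^8 + y^8 / \<kappa>) / 2"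
proof -
  have "0 \<le> (\<kappa> * x^4 - y^4)\<^sup>2 / \<kappa>" using assms by simp
  also have "\<dots> = \<kappa> * x^8 + y^8 / \<kappa> - 2 * (x^4 * y^4)"
    using assms by (simp add: power2_diff power_mult_distrib field_simps) (simp add: power2_eq_square)
  finally show ?thesis by simp
qed

lemma power4_sum_le: "(x + y)^4 \<le> 8 * x^4 + 8 * (y::real)^4"
proof -
  have "(x + y)^4 = ((x + y)\<^sup>2)\<^sup>2" by simp
  also have "\<dots> \<le> (2 * x\<^sup>2 + 2 * y\<^sup>2)\<^sup>2" by (intro power_mono square_sum_le) simp
  also have "\<dots> \<le> 2 * (2 * x\<^sup>2)\<^sup>2 + 2 * (2 * y\<^sup>2)\<^sup>2" by (rule square_sum_le)
  finally show ?thesis by (simp add: power_mult_distrib)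
qed

lemma power8_sum_le: "(x + y)^8 \<le> 128 * x^8 + 128 * (y::real)^8"
proof -
  have "(x + y)^8 = ((x + y)^4)\<^sup>2" by simp
  also have "\<dots> \<le> (8 * x^4 + 8 * y^4)\<^sup>2" by (intro power_mono power4_sum_le) simp
  also have "\<dots> \<le> 2 * (8 * x^4)\<^sup>2 + 2 * (8 * y^4)\<^sup>2" by (rule square_sum_le)
  finally show ?thesis by (simp add: power_mult_distrib)
qed

text \<open>The model after rescaling to unit total variance: b is the scaled \<beta> and the noise
  variance is 1 - |b|^2. The bound 105 is the eighth moment of a standard normal, since that
  variance is at most 1. Test functions g replace conditional expectations.\<close>

locale regression_observation = prob_space M for M :: "'a measure" +
  fixes p :: nat and X :: "'a \<Rightarrow> nat \<Rightarrow> real" and e :: "'a \<Rightarrow> real" and b :: "nat \<Rightarrow> real"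
  assumes X [measurable]: "X \<in> measurable M (Rvec p)"
    and X_distr: "distr M (Rvec p) X = std_normal_vec p"
    and p_pos: "0 < p"
    and e [measurable]: "e \<in> borel_measurable M"
    and b_le: "sqnorm p b \<le> 1"
    and int_e8: "integrable M (\<lambda>\<omega>. (e \<omega>)^8)"
    and E_e8: "(\<integral>\<omega>. (e \<omega>)^8 \<partial>M) \<le> 105"
    and E_mult_e: "\<And>g. g \<in> borel_measurable (Rvec p) \<Longrightarrow> integrable M (\<lambda>\<omega>. g (X \<omega>) * e \<omega>) \<Longrightarrow>
      (\<integral>\<omega>. g (X \<omega>) * e \<omega> \<partial>M) = 0"
    and E_mult_e2: "\<And>g. g \<in> borel_measurable (Rvec p) \<Longrightarrow> integrable M (\<lambda>\<omega>. g (X \<omega>) * (e \<omega>)\<^sup>2) \<Longrightarrow>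
      (\<integral>\<omega>. g (X \<omega>) * (e \<omega>)\<^sup>2 \<partial>M) = (1 - sqnorm p b) * (\<integral>\<omega>. g (X \<omega>) \<partial>M)"
begin

abbreviation l :: "(nat \<Rightarrow> real) \<Rightarrow> 'a \<Rightarrow> real" where
  "l c \<omega> \<equiv> dot p c (X \<omega>)"

definition y :: "'a \<Rightarrow> real" where
  "y \<omega> = l b \<omega> + e \<omega>"

definition V :: "'a \<Rightarrow> nat \<Rightarrow> real" where
  "V \<omega> = (\<lambda>j\<in>{..<p}. y \<omega> * X \<omega> j - b j)"

lemma X_component [measurable (raw)]: "j < p \<Longrightarrow> (\<lambda>\<omega>. X \<omega> j) \<in> borel_measurable M"
  by (rule measurable_compose[OF X]) simp

lemma rv_y [measurable]: "y \<in> borel_measurable M"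
  unfolding y_def by measurable

lemma rv_V [measurable]: "V \<in> measurable M (Rvec p)"
  unfolding V_def by measurable

lemma dot_V: "dot p c (V \<omega>) = l c \<omega> * y \<omega> - dot p c b"
  unfolding V_def dot_restrict_right dot_diff_right dot_scale_right by simp

lemmas int_l = std_normal_vec_dot_moment(1)[OF X X_distr]
lemmas E_l = std_normal_vec_dot_moment(2)[OF X X_distr]

lemma int_l2: "integrable M (\<lambda>\<omega>. (l c \<omega>)\<^sup>2)" and E_l2: "(\<integral>\<omega>. (l c \<omega>)\<^sup>2 \<partial>M) = sqnorm p c"
  using int_l[of c 1] E_l[of c 1] by (simp_all add: fact_numeral)

lemma int_l4: "integrable M (\<lambda>\<omega>. (l c \<omega>)^4)" and E_l4: "(\<integral>\<omega>. (l c \<omega>)^4 \<partial>M) = 3 * (sqnorm p c)\<^sup>2"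
  using int_l[of c 2] E_l[of c 2] by (simp_all add: fact_numeral)

lemma int_l8: "integrable M (\<lambda>\<omega>. (l c \<omega>)^8)" and E_l8: "(\<integral>\<omega>. (l c \<omega>)^8 \<partial>M) = 105 * (sqnorm p c)^4"
  using int_l[of c 4] E_l[of c 4] by (simp_all add: fact_numeral)

lemma int_e4: "integrable M (\<lambda>\<omega>. (e \<omega>)^4)"
  by (rule square_integrable_imp_integrable) (use int_e8 in simp_all)

lemma int_e2: "integrable M (\<lambda>\<omega>. (e \<omega>)\<^sup>2)"
  by (rule square_integrable_imp_integrable) (use int_e4 in simp_all)

text \<open>26880 = 128 * (105 + 105), one 105 for the signal and one for the noise.\<close>

lemma int_y8: "integrable M (\<lambda>\<omega>. (y \<omega>)^8)" and E_y8: "(\<integral>\<omega>. (y \<omega>)^8 \<partial>M) \<le> 26880"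
proof -
  have le: "(y \<omega>)^8 \<le> 128 * (l b \<omega>)^8 + 128 * (e \<omega>)^8" for \<omega>
    unfolding y_def by (rule power8_sum_le)
  have int: "integrable M (\<lambda>\<omega>. 128 * (l b \<omega>)^8 + 128 * (e \<omega>)^8)"
    using int_l8[of b] int_e8 by simp
  show *: "integrable M (\<lambda>\<omega>. (y \<omega>)^8)"
    by (rule Bochner_Integration.integrable_bound[OF int]) (use le in \<open>auto simp: zero_le_even_power\<close>)
  have "(\<integral>\<omega>. (y \<omega>)^8 \<partial>M) \<le> (\<integral>\<omega>. 128 * (l b \<omega>)^8 + 128 * (e \<omega>)^8 \<partial>M)"
    by (rule integral_mono[OF * int le])
  also have "\<dots> = 128 * (105 * (sqnorm p b)^4) + 128 * (\<integral>\<omega>. (e \<omega>)^8 \<partial>M)"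
    using int_l8[of b] int_e8 by (simp add: E_l8)
  also have "\<dots> \<le> 128 * (105 * 1) + 128 * 105"
    by (intro add_mono mult_left_mono E_e8 power_le_one sqnorm_nonneg b_le) auto
  finally show "(\<integral>\<omega>. (y \<omega>)^8 \<partial>M) \<le> 26880" by simp
qed

lemma int_l_l: "integrable M (\<lambda>\<omega>. l c \<omega> * l d \<omega>)"
  by (rule integrable_mult_of_squares) (simp_all add: int_l2)

lemma int_l2_l2: "integrable M (\<lambda>\<omega>. (l c \<omega>)\<^sup>2 * (l d \<omega>)\<^sup>2)"
  by (rule integrable_mult_of_squares) (simp_all add: int_l4)

lemma int_l_e: "integrable M (\<lambda>\<omega>. l c \<omega> * e \<omega>)"
  by (rule integrable_mult_of_squares) (simp_all add: int_l2 int_e2)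

lemma int_l2_e2: "integrable M (\<lambda>\<omega>. (l c \<omega>)\<^sup>2 * (e \<omega>)\<^sup>2)"
  by (rule integrable_mult_of_squares) (simp_all add: int_l4 int_e4)

lemma int_l2_l_e: "integrable M (\<lambda>\<omega>. (l c \<omega>)\<^sup>2 * l d \<omega> * e \<omega>)"
proof -
  \<comment> \<open>Grouped so that each factor is square integrable.\<close>
  have "integrable M (\<lambda>\<omega>. (l c \<omega> * l d \<omega>) * (l c \<omega> * e \<omega>))"
    by (rule integrable_mult_of_squares) (simp_all add: power_mult_distrib int_l2_l2 int_l2_e2)
  then show ?thesis by (simp add: power2_eq_square ac_simps)
qed

lemma E_l_l: "(\<integral>\<omega>. l c \<omega> * l d \<omega> \<partial>M) = dot p c d"
proof -
  have "(\<integral>\<omega>. (l (\<lambda>j. c j + d j) \<omega>)\<^sup>2 \<partial>M) = (\<integral>\<omega>. (l c \<omega>)\<^sup>2 + (l d \<omega>)\<^sup>2 + 2 * (l c \<omega> * l d \<omega>) \<partial>M)"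
    by (simp add: dot_add_left power2_sum mult.assoc)
  also have "\<dots> = sqnorm p c + sqnorm p d + 2 * (\<integral>\<omega>. l c \<omega> * l d \<omega> \<partial>M)"
    using int_l2[of c] int_l2[of d] int_l_l[of c d] by (simp add: E_l2)
  finally show ?thesis by (simp add: E_l2 sqnorm_add)
qed

text \<open>Isserlis' formula, obtained by polarising the fourth moments of \<open>l (c + d)\<close> and \<open>l (c - d)\<close>.\<close>

lemma E_l2_l2: "(\<integral>\<omega>. (l c \<omega>)\<^sup>2 * (l d \<omega>)\<^sup>2 \<partial>M) = sqnorm p c * sqnorm p d + 2 * (dot p c d)\<^sup>2"
proof -
  have pol: "(u + w)^4 + (u - w)^4 = 2 * u^4 + 2 * w^4 + 12 * (u\<^sup>2 * w\<^sup>2)" for u w :: real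
    by (simp add: power4_eq_xxxx power2_eq_square algebra_simps)
  have minus: "sqnorm p (\<lambda>j. c j - d j) = sqnorm p c - 2 * dot p c d + sqnorm p d"
    by (simp add: sqnorm_eq_dot dot_simps dot_commute[of p d c])
  have "(\<integral>\<omega>. (l (\<lambda>j. c j + d j) \<omega>)^4 + (l (\<lambda>j. c j - d j) \<omega>)^4 \<partial>M)
      = (\<integral>\<omega>. 2 * (l c \<omega>)^4 + 2 * (l d \<omega>)^4 + 12 * ((l c \<omega>)\<^sup>2 * (l d \<omega>)\<^sup>2) \<partial>M)"
    unfolding dot_add_left dot_diff_left pol ..
  also have "\<dots> = 2 * (3 * (sqnorm p c)\<^sup>2) + 2 * (3 * (sqnorm p d)\<^sup>2) + 12 * (\<integral>\<omega>. (l c \<omega>)\<^sup>2 * (l d \<omega>)\<^sup>2 \<partial>M)"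
    using int_l4[of c] int_l4[of d] int_l2_l2[of c d] by (simp add: E_l4)
  also have "(\<integral>\<omega>. (l (\<lambda>j. c j + d j) \<omega>)^4 + (l (\<lambda>j. c j - d j) \<omega>)^4 \<partial>M)
      = 3 * (sqnorm p (\<lambda>j. c j + d j))\<^sup>2 + 3 * (sqnorm p (\<lambda>j. c j - d j))\<^sup>2"
    using int_l4 by (simp add: E_l4)
  finally show ?thesis
    unfolding sqnorm_add minus by (simp add: power2_eq_square algebra_simps)
qed

lemma int_ly: "integrable M (\<lambda>\<omega>. l c \<omega> * y \<omega>)"
  using int_l_l[of c b] int_l_e[of c] by (simp add: y_def distrib_left)

lemma E_ly: "(\<integral>\<omega>. l c \<omega> * y \<omega> \<partial>M) = dot p c b"
proof -
  have "(\<integral>\<omega>. l c \<omega> * e \<omega> \<partial>M) = 0"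
    by (rule E_mult_e[OF _ int_l_e]) measurable
  then show ?thesis
    using int_l_l[of c b] int_l_e[of c] by (simp add: y_def distrib_left E_l_l)
qed

lemma l2y2: "(l c \<omega> * y \<omega>)\<^sup>2 = (l c \<omega>)\<^sup>2 * (l b \<omega>)\<^sup>2 + 2 * ((l c \<omega>)\<^sup>2 * l b \<omega> * e \<omega>) + (l c \<omega>)\<^sup>2 * (e \<omega>)\<^sup>2"
  by (simp add: y_def power2_eq_square algebra_simps)

lemma int_l2y2: "integrable M (\<lambda>\<omega>. (l c \<omega> * y \<omega>)\<^sup>2)"
  unfolding l2y2 using int_l2_l2[of c b] int_l2_l_e[of c b] int_l2_e2[of c] by simp

text \<open>The signal gives |c|^2 |b|^2 + 2 (c.b)^2, the noise (1 - |b|^2) |c|^2, and the mixed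
  term vanishes; the normalisation cancels |b|^2.\<close>

lemma E_l2y2: "(\<integral>\<omega>. (l c \<omega> * y \<omega>)\<^sup>2 \<partial>M) = sqnorm p c + 2 * (dot p c b)\<^sup>2"
proof -
  have 1: "(\<integral>\<omega>. (l c \<omega>)\<^sup>2 * l b \<omega> * e \<omega> \<partial>M) = 0"
    by (rule E_mult_e[of "\<lambda>x. (dot p c x)\<^sup>2 * dot p b x", OF _ int_l2_l_e]) measurable
  have 2: "(\<integral>\<omega>. (l c \<omega>)\<^sup>2 * (e \<omega>)\<^sup>2 \<partial>M) = (1 - sqnorm p b) * sqnorm p c"
    by (subst E_mult_e2[of "\<lambda>x. (dot p c x)\<^sup>2", OF _ int_l2_e2]) (measurable, simp add: E_l2)
  have "(\<integral>\<omega>. f \<omega> + 2 * g \<omega> + h \<omega> \<partial>M) = (\<integral>\<omega>. f \<omega> \<partial>M) + 2 * (\<integral>\<omega>. g \<omega> \<partial>M) + (\<integral>\<omega>. h \<omega> \<partial>M)"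
    if "integrable M f" "integrable M g" "integrable M h" for f g h :: "'a \<Rightarrow> real"
    using that by simp
  from this[OF int_l2_l2[of c b] int_l2_l_e[of c b] int_l2_e2[of c], unfolded 1 2 E_l2_l2] show ?thesis
    unfolding l2y2 by (simp add: algebra_simps)
qed

lemma E_dot_V: "(\<integral>\<omega>. dot p c (V \<omega>) \<partial>M) = 0"
  unfolding dot_V using int_ly[of c] by (simp add: E_ly prob_space)

lemma E_dot2_V: "(\<integral>\<omega>. (dot p c (V \<omega>))\<^sup>2 \<partial>M) = sqnorm p c + (dot p b c)\<^sup>2"
proof -
  have "(\<integral>\<omega>. (f \<omega> - a)\<^sup>2 \<partial>M) = (\<integral>\<omega>. (f \<omega>)\<^sup>2 \<partial>M) + a\<^sup>2 - 2 * (\<integral>\<omega>. f \<omega> \<partial>M) * a"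
    if "integrable M f" "integrable M (\<lambda>\<omega>. (f \<omega>)\<^sup>2)" for f :: "'a \<Rightarrow> real" and a
    using that by (simp add: power2_diff prob_space)
  from this[OF int_ly int_l2y2] show ?thesis
    unfolding dot_V E_ly E_l2y2 by (simp add: power2_eq_square dot_commute[of p b c])
qed

text \<open>The constant is \<open>8 * (26880 + 105) / 2 + 8\<close>, with \<open>26880\<close> from \<open>E_y8\<close> and \<open>105 = E Z\<^sup>8\<close> for a standard
  normal \<open>Z\<close>; the same constant serves in \<open>E_V4\<close> below.\<close>

lemma E_dot4_V: "(\<integral>\<omega>. (dot p c (V \<omega>))^4 \<partial>M) \<le> 107948 * (sqnorm p c)\<^sup>2"
proof (cases "sqnorm p c = 0")
  case True
  have "dot p c u = 0" for u
    using dot_Cauchy_Schwarz[of p c u] True by simp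
  then show ?thesis using True by simp
next
  case False
  \<comment> \<open>With weight |c|^4 both halves of \<open>fourth_powers_le\<close> scale like
    |c|^4, since the eighth moment of c.X is of order |c|^8.\<close>
  then have \<kappa>: "0 < (sqnorm p c)\<^sup>2" by simp
  let ?B = "\<lambda>\<omega>. 8 * (((sqnorm p c)\<^sup>2 * (y \<omega>)^8 + (l c \<omega>)^8 / (sqnorm p c)\<^sup>2) / 2) + 8 * (sqnorm p c)\<^sup>2"
  have le: "(dot p c (V \<omega>))^4 \<le> ?B \<omega>" for \<omega>
  proof -
    have "(dot p c (V \<omega>))^4 = (l c \<omega> * y \<omega> + (- dot p c b))^4" by (simp add: dot_V)
    also have "\<dots> \<le> 8 * (l c \<omega> * y \<omega>)^4 + 8 * (- dot p c b)^4" by (rule power4_sum_le)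
    also have "\<dots> \<le> ?B \<omega>"
    proof (intro add_mono mult_left_mono)
      show "(l c \<omega> * y \<omega>)^4 \<le> ((sqnorm p c)\<^sup>2 * (y \<omega>)^8 + (l c \<omega>)^8 / (sqnorm p c)\<^sup>2) / 2"
        using fourth_powers_le[OF \<kappa>, of "y \<omega>" "l c \<omega>"] by (simp add: power_mult_distrib mult.commute)
      have "(- dot p c b)^4 = ((dot p c b)\<^sup>2)\<^sup>2" by simp
      also have "\<dots> \<le> (sqnorm p c * sqnorm p b)\<^sup>2" by (intro power_mono dot_Cauchy_Schwarz) simp
      also have "\<dots> \<le> (sqnorm p c * 1)\<^sup>2"
        by (intro power_mono mult_left_mono b_le sqnorm_nonneg mult_nonneg_nonneg)
      finally show "(- dot p c b)^4 \<le> (sqnorm p c)\<^sup>2" by simp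
    qed auto
    finally show ?thesis .
  qed
  have "(\<integral>\<omega>. (dot p c (V \<omega>))^4 \<partial>M) \<le> (\<integral>\<omega>. ?B \<omega> \<partial>M)"
  proof (rule integral_mono'[OF _ le])
    show "integrable M ?B" using int_y8 int_l8[of c] by simp
    show "0 \<le> ?B \<omega>" for \<omega> by (intro add_nonneg_nonneg mult_nonneg_nonneg divide_nonneg_nonneg) auto
  qed
  also have "\<dots> = 8 * (((sqnorm p c)\<^sup>2 * (\<integral>\<omega>. (y \<omega>)^8 \<partial>M) + 105 * (sqnorm p c)^4 / (sqnorm p c)\<^sup>2) / 2) + 8 * (sqnorm p c)\<^sup>2"
    using int_y8 int_l8[of c] by (simp add: E_l8 prob_space)
  also have "\<dots> \<le> 8 * (((sqnorm p c)\<^sup>2 * 26880 + 105 * (sqnorm p c)^4 / (sqnorm p c)\<^sup>2) / 2) + 8 * (sqnorm p c)\<^sup>2"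
    by (intro add_mono mult_left_mono divide_right_mono E_y8) auto
  also have "105 * (sqnorm p c)^4 / (sqnorm p c)\<^sup>2 = 105 * (sqnorm p c)\<^sup>2"
    using False by (simp add: power4_eq_xxxx power2_eq_square)
  finally show ?thesis by simp
qed

lemma int_V4: "integrable M (\<lambda>\<omega>. (sqnorm p (V \<omega>))\<^sup>2)"
  and E_V4: "(\<integral>\<omega>. (sqnorm p (V \<omega>))\<^sup>2 \<partial>M) \<le> 107948 * (real p)\<^sup>2"
proof -
  have p: "0 < (real p)\<^sup>2" using p_pos by simp
  let ?S = "\<lambda>\<omega>. \<Sum>j<p. (X \<omega> j)^8"
  let ?B = "\<lambda>\<omega>. 8 * (((real p)\<^sup>2 * (y \<omega>)^8 + (real p)^3 * ?S \<omega> / (real p)\<^sup>2) / 2) + 8"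
  have le: "(sqnorm p (V \<omega>))\<^sup>2 \<le> ?B \<omega>" for \<omega>
  proof -
    have "sqnorm p (V \<omega>) = sqnorm p (\<lambda>j. y \<omega> * X \<omega> j + (- 1) * b j)"
      by (simp add: V_def sqnorm_def)
    also have "\<dots> \<le> 2 * ((y \<omega>)\<^sup>2 * sqnorm p (X \<omega>)) + 2 * ((- 1)\<^sup>2 * sqnorm p b)"
      using sqnorm_add_le[of p "\<lambda>j. y \<omega> * X \<omega> j" "\<lambda>j. (- 1) * b j"] by (simp only: sqnorm_scale)
    finally have "sqnorm p (V \<omega>) \<le> 2 * ((y \<omega>)\<^sup>2 * sqnorm p (X \<omega>)) + 2 * 1"
      using b_le by simp
    then have "(sqnorm p (V \<omega>))\<^sup>2 \<le> (2 * ((y \<omega>)\<^sup>2 * sqnorm p (X \<omega>)) + 2 * 1)\<^sup>2"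
      by (intro power_mono sqnorm_nonneg)
    also have "\<dots> \<le> 2 * (2 * ((y \<omega>)\<^sup>2 * sqnorm p (X \<omega>)))\<^sup>2 + 2 * (2 * 1)\<^sup>2"
      by (rule square_sum_le)
    \<comment> \<open>Writing |X|^4 as a fourth power of the norm brings it into the shape of
      \<open>fourth_powers_le\<close>. The weight p^2 fits because E|X|^8 is of order p^4.\<close>
    also have "\<dots> = 8 * ((y \<omega>)^4 * (sqrt (sqnorm p (X \<omega>)))^4) + 8"
      using sqnorm_nonneg[of p "X \<omega>"]
      by (simp add: power_mult_distrib power4_eq_xxxx power2_eq_square)
    also have "\<dots> \<le> 8 * (((real p)\<^sup>2 * (y \<omega>)^8 + (sqrt (sqnorm p (X \<omega>)))^8 / (real p)\<^sup>2) / 2) + 8"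
      by (intro add_right_mono mult_left_mono fourth_powers_le p) auto
    also have "(sqrt (sqnorm p (X \<omega>)))^8 = ((sqrt (sqnorm p (X \<omega>)))\<^sup>2)^4"
      by (simp only: power_mult[symmetric]) simp
    also have "\<dots> = (sqnorm p (X \<omega>))^4" by (simp only: real_sqrt_pow2[OF sqnorm_nonneg])
    also have "8 * (((real p)\<^sup>2 * (y \<omega>)^8 + (sqnorm p (X \<omega>))^4 / (real p)\<^sup>2) / 2) + 8 \<le> ?B \<omega>"
      by (intro add_right_mono mult_left_mono divide_right_mono add_left_mono sqnorm_fourth_power_le) auto
    finally show ?thesis .
  qed
  let ?e = "\<lambda>j k. if k = j then 1 else (0::real)"
  have X8: "integrable M (\<lambda>\<omega>. (X \<omega> j)^8)" "(\<integral>\<omega>. (X \<omega> j)^8 \<partial>M) = 105" if "j < p" for j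
    using int_l8[of "?e j"] E_l8[of "?e j"] that by (simp_all add: dot_unit sqnorm_eq_dot)
  have iS: "integrable M ?S" by (intro Bochner_Integration.integrable_sum X8(1)) simp
  then have iB: "integrable M ?B"
    by (intro Bochner_Integration.integrable_add integrable_mult_right integrable_divide integrable_const int_y8)
  show iV: "integrable M (\<lambda>\<omega>. (sqnorm p (V \<omega>))\<^sup>2)"
  proof (rule Bochner_Integration.integrable_bound[OF iB])
    have "\<bar>(sqnorm p (V \<omega>))\<^sup>2\<bar> \<le> \<bar>?B \<omega>\<bar>" for \<omega> using le[of \<omega>] by (simp only: abs_of_nonneg[OF zero_le_power2])
    then show "AE \<omega> in M. norm ((sqnorm p (V \<omega>))\<^sup>2) \<le> norm (?B \<omega>)" by simp
    show "(\<lambda>\<omega>. (sqnorm p (V \<omega>))\<^sup>2) \<in> borel_measurable M"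
      by measurable
  qed
  have "(\<integral>\<omega>. (sqnorm p (V \<omega>))\<^sup>2 \<partial>M) \<le> (\<integral>\<omega>. ?B \<omega> \<partial>M)"
    by (rule integral_mono[OF iV iB le])
  also have "\<dots> = 8 * (((real p)\<^sup>2 * (\<integral>\<omega>. (y \<omega>)^8 \<partial>M) + (real p)^3 * (\<Sum>j<p. 105) / (real p)\<^sup>2) / 2) + 8"
  proof -
    have "(\<integral>\<omega>. ?S \<omega> \<partial>M) = (\<Sum>j<p. 105)"
      by (subst Bochner_Integration.integral_sum) (simp_all add: X8)
    moreover have "(\<integral>\<omega>. 8 * ((a * f \<omega> + c * h \<omega> / a) / 2) + 8 \<partial>M)
        = 8 * ((a * (\<integral>\<omega>. f \<omega> \<partial>M) + c * (\<integral>\<omega>. h \<omega> \<partial>M) / a) / 2) + 8"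
      if "integrable M f" "integrable M h" for f h :: "'a \<Rightarrow> real" and a c
      using that by (simp add: prob_space)
    note this[OF int_y8 iS]
    ultimately show ?thesis by simp
  qed
  also have "\<dots> \<le> 8 * (((real p)\<^sup>2 * 26880 + (real p)^3 * (\<Sum>j<p. 105) / (real p)\<^sup>2) / 2) + 8 * (real p)\<^sup>2"
    using p_pos by (intro add_mono mult_left_mono divide_right_mono E_y8) auto
  also have "(real p)^3 * (\<Sum>j<p. 105) / (real p)\<^sup>2 = 105 * (real p)\<^sup>2"
    using p_pos by (simp add: power2_eq_square power3_eq_cube)
  finally show "(\<integral>\<omega>. (sqnorm p (V \<omega>))\<^sup>2 \<partial>M) \<le> 107948 * (real p)\<^sup>2" by simp
qed

end

section \<open>The standardised estimator\<close>

lemma sum_off_diagonal: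
  fixes a :: "nat \<Rightarrow> real"
  shows "(\<Sum>i<n. \<Sum>k\<in>{..<n} - {i}. a i * a k) = (\<Sum>i<n. a i)\<^sup>2 - (\<Sum>i<n. (a i)\<^sup>2)"
proof -
  have "(\<Sum>k\<in>{..<n} - {i}. a i * a k) = a i * (\<Sum>k<n. a k) - (a i)\<^sup>2" if "i < n" for i
    using that by (simp add: sum_diff1 sum_distrib_left power2_eq_square)
  then show ?thesis
    by (simp add: sum_subtractf power2_eq_square flip: sum_distrib_right)
qed

lemma sum_below_diagonal:
  fixes a :: "nat \<Rightarrow> real"
  shows "2 * (\<Sum>i<n. (\<Sum>k<i. a k) * a i) = (\<Sum>i<n. a i)\<^sup>2 - (\<Sum>i<n. (a i)\<^sup>2)"
  by (induction n) (simp_all add: power2_sum algebra_simps)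

text \<open>Hoeffding's decomposition in one coordinate, with c as the mean: a degenerate quadratic
  part, a linear part and the constant.\<close>

lemma sum_off_diagonal_shift:
  fixes a :: "nat \<Rightarrow> real"
  shows "(\<Sum>i<n. \<Sum>k\<in>{..<n} - {i}. (a i + c) * (a k + c))
    = 2 * (\<Sum>i<n. (\<Sum>k<i. a k) * a i) + 2 * (real n - 1) * (\<Sum>i<n. c * a i) + real n * (real n - 1) * c\<^sup>2"
proof -
  have "(\<Sum>i<n. \<Sum>k\<in>{..<n} - {i}. (a i + c) * (a k + c)) = (\<Sum>i<n. a i + c)\<^sup>2 - (\<Sum>i<n. (a i + c)\<^sup>2)"
    by (rule sum_off_diagonal)
  also have "\<dots> = ((\<Sum>i<n. a i)\<^sup>2 - (\<Sum>i<n. (a i)\<^sup>2)) + 2 * (real n - 1) * (c * (\<Sum>i<n. a i)) + real n * (real n - 1) * c\<^sup>2"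
    by (simp add: sum.distrib power2_sum sum_distrib_left[symmetric] sum_distrib_right[symmetric])
      (simp add: power2_eq_square algebra_simps)
  finally show ?thesis by (simp only: sum_below_diagonal[symmetric] sum_distrib_left)
qed

lemma (in spiked_sample) sum_off_diagonal_products:
  "(\<Sum>j<p. \<Sum>i<n. \<Sum>k\<in>{..<n} - {i}. (V i \<omega> j + b j) * (V k \<omega> j + b j))
    = 2 * (\<Sum>i<n. dot p (P i \<omega>) (V i \<omega>)) + 2 * (real n - 1) * (\<Sum>i<n. dot p b (V i \<omega>))
      + real n * (real n - 1) * q"
proof -
  have "(\<Sum>i<n. dot p (P i \<omega>) (V i \<omega>)) = (\<Sum>j<p. \<Sum>i<n. (\<Sum>k<i. V k \<omega> j) * V i \<omega> j)"
    unfolding dot_def P_def by (subst sum.swap) simp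
  moreover have "(\<Sum>i<n. dot p b (V i \<omega>)) = (\<Sum>j<p. \<Sum>i<n. b j * V i \<omega> j)"
    unfolding dot_def by (rule sum.swap)
  ultimately show ?thesis
    unfolding sum_off_diagonal_shift sqnorm_def
    by (simp add: sum.distrib sum_distrib_left)
qed

text \<open>The finite-sample form of the theorem. The bound involves only n, p and t, so it applies
  along any array of parameters.\<close>

lemma char_statistic:
  fixes M :: "'a measure" and X :: "nat \<Rightarrow> 'a \<Rightarrow> nat \<Rightarrow> real" and Y \<epsilon> :: "nat \<Rightarrow> 'a \<Rightarrow> real"
    and \<beta> :: "nat \<Rightarrow> real" and \<sigma> :: real
  assumes prob: "prob_space M"
    and indep: "prob_space.indep_vars M (\<lambda>_. Rvec p \<Otimes>\<^sub>M borel) (\<lambda>i \<omega>. (X i \<omega>, Y i \<omega>)) {..<n}"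
    and model: "\<And>i \<omega>. i < n \<Longrightarrow> \<omega> \<in> space M \<Longrightarrow> Y i \<omega> = (\<Sum>j<p. \<beta> j * X i \<omega> j) + \<epsilon> i \<omega>"
    and cond_mean: "\<And>i. i < n \<Longrightarrow> AE \<omega> in M. real_cond_exp M (sigma_gen M p (X i)) (\<epsilon> i) \<omega> = 0"
    and cond_var: "\<And>i. i < n \<Longrightarrow>
      AE \<omega> in M. real_cond_exp M (sigma_gen M p (X i)) (\<lambda>\<omega>. (\<epsilon> i \<omega>)\<^sup>2) \<omega> = \<sigma>\<^sup>2"
    and X_normal: "\<And>i. i < n \<Longrightarrow> distr M (Rvec p) (X i) = std_normal_vec p"
    and eps_normal: "\<And>i. i < n \<Longrightarrow> distr M borel (\<epsilon> i) = normal_distr 0 \<sigma>"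
    and \<sigma>: "0 \<le> \<sigma>" and pos: "0 < sqnorm p \<beta> + \<sigma>\<^sup>2" and n: "2 \<le> n" and p: "0 < p"
  defines "T \<equiv> \<lambda>\<omega>. sqrt (real n) * ((tau2_hat n p X Y \<omega> - sqnorm p \<beta>) / psi n p (sqnorm p \<beta>) (\<sigma>\<^sup>2))"
  shows "T \<in> borel_measurable M"
    and "cmod (char (distr M borel T) t - char std_normal_distribution t) \<le> char_error 107948 n p t"
proof -
  interpret prob_space M by (rule prob)
  define s where "s = sqnorm p \<beta> + \<sigma>\<^sup>2"
  define r where "r = 1 / sqrt s"
  define b where "b j = r * \<beta> j" for j
  \<comment> \<open>equals \<open>r * \<epsilon> i \<omega>\<close>, but only on \<open>space M\<close>, where the model equation holds\<close>
  define e where "e i \<omega> = r * Y i \<omega> - dot p b (X i \<omega>)" for i \<omega>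
  define V where "V i \<omega> = (\<lambda>j\<in>{..<p}. (r * Y i \<omega>) * X i \<omega> j - b j)" for i \<omega>
  have s: "0 < s" using pos by (simp add: s_def)
  have r: "0 < r" "r\<^sup>2 = 1 / s" using s by (simp_all add: r_def power_divide)
  have qb: "sqnorm p b = sqnorm p \<beta> / s"
    unfolding b_def[abs_def] sqnorm_scale r(2) by simp
  have q1: "1 - sqnorm p b = r\<^sup>2 * \<sigma>\<^sup>2"
    unfolding qb r(2) using s by (simp add: s_def field_simps)
  have b_le: "sqnorm p b \<le> 1" using q1 by (metis diff_ge_0_iff_ge mult_nonneg_nonneg zero_le_power2)
  have XY [measurable]: "X i \<in> measurable M (Rvec p)" "Y i \<in> borel_measurable M" if "i < n" for i
  proof -
    have *: "(\<lambda>\<omega>. (X i \<omega>, Y i \<omega>)) \<in> measurable M (Rvec p \<Otimes>\<^sub>M borel)"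
      using indep that by (auto simp: indep_vars_def)
    show "X i \<in> measurable M (Rvec p)" using measurable_compose[OF * measurable_fst] by simp
    show "Y i \<in> borel_measurable M" using measurable_compose[OF * measurable_snd] by simp
  qed
  have Xc [measurable (raw)]: "(\<lambda>\<omega>. X i \<omega> j) \<in> borel_measurable M" if "i < n" "j < p" for i j
    using measurable_compose[OF XY(1)[OF that(1)] measurable_component_singleton[of j]] that(2) by simp
  have e_eq: "e i \<omega> = r * \<epsilon> i \<omega>" if "i < n" "\<omega> \<in> space M" for i \<omega>
  proof -
    have "(\<Sum>j<p. \<beta> j * X i \<omega> j) = dot p \<beta> (X i \<omega>)" by (simp add: dot_def)
    then show ?thesis
      unfolding e_def b_def[abs_def] dot_scale_left model[OF that] by (simp add: algebra_simps)
  qed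
  have obs: "regression_observation M p (X i) (e i) b" if i: "i < n" for i
  proof
    note XY(1)[OF i, measurable] XY(2)[OF i, measurable]
    show "X i \<in> measurable M (Rvec p)" by (rule XY(1)[OF i])
    show "distr M (Rvec p) (X i) = std_normal_vec p" by (rule X_normal[OF i])
    show em [measurable]: "e i \<in> borel_measurable M"
      unfolding e_def[abs_def] using Xc[OF i] by measurable
    \<comment> \<open>The noise inherits measurability from X and Y through the model equation on
      \<open>space M\<close>.\<close>
    have "(\<lambda>\<omega>. e i \<omega> / r) \<in> borel_measurable M" by measurable
    then have eps_meas [measurable]: "\<epsilon> i \<in> borel_measurable M"
      by (rule measurable_cong[THEN iffD1, rotated]) (use e_eq[OF i] r in auto)
    note mom = normal_distr_moment[of "\<epsilon> i", OF eps_meas eps_normal[OF i] \<sigma>, of 4, simplified]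
    have "integrable M (\<lambda>\<omega>. r^8 * (\<epsilon> i \<omega>)^8)" using mom(1) by simp
    then show "integrable M (\<lambda>\<omega>. (e i \<omega>)^8)"
      by (rule Bochner_Integration.integrable_cong[THEN iffD1, OF refl, rotated])
        (simp add: e_eq[OF i] power_mult_distrib)
    have "(\<integral>\<omega>. (e i \<omega>)^8 \<partial>M) = (\<integral>\<omega>. r^8 * (\<epsilon> i \<omega>)^8 \<partial>M)"
      by (rule Bochner_Integration.integral_cong) (simp_all add: e_eq[OF i] power_mult_distrib)
    also have "\<dots> = 105 * (1 - sqnorm p b)^4"
      unfolding q1 using mom(2) by (simp add: fact_numeral power_mult_distrib flip: power_mult)
    also have "\<dots> \<le> 105 * 1"
      using b_le sqnorm_nonneg[of p b] by (intro mult_left_mono power_le_one) auto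
    finally show "(\<integral>\<omega>. (e i \<omega>)^8 \<partial>M) \<le> 105" by simp
    fix g :: "(nat \<Rightarrow> real) \<Rightarrow> real"
    assume g [measurable]: "g \<in> borel_measurable (Rvec p)"
    show "(\<integral>\<omega>. g (X i \<omega>) * e i \<omega> \<partial>M) = 0" if int: "integrable M (\<lambda>\<omega>. g (X i \<omega>) * e i \<omega>)"
    proof -
      have eq: "g (X i \<omega>) * e i \<omega> = (r * g (X i \<omega>)) * \<epsilon> i \<omega>" if "\<omega> \<in> space M" for \<omega>
        by (simp add: e_eq[OF i that])
      have "integrable M (\<lambda>\<omega>. (r * g (X i \<omega>)) * \<epsilon> i \<omega>)"
        using int by (rule Bochner_Integration.integrable_cong[THEN iffD1, OF refl, rotated]) (rule eq)
      then have "(\<integral>\<omega>. (r * g (X i \<omega>)) * \<epsilon> i \<omega> \<partial>M) = 0"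
        using integral_mult_cond_exp_const[OF XY(1)[OF i] eps_meas, of "\<lambda>x. r * g x", OF _ cond_mean[OF i]] by simp
      moreover have "(\<integral>\<omega>. g (X i \<omega>) * e i \<omega> \<partial>M) = (\<integral>\<omega>. (r * g (X i \<omega>)) * \<epsilon> i \<omega> \<partial>M)"
        by (rule Bochner_Integration.integral_cong[OF refl eq])
      ultimately show ?thesis by simp
    qed
    show "(\<integral>\<omega>. g (X i \<omega>) * (e i \<omega>)\<^sup>2 \<partial>M) = (1 - sqnorm p b) * (\<integral>\<omega>. g (X i \<omega>) \<partial>M)"
      if int: "integrable M (\<lambda>\<omega>. g (X i \<omega>) * (e i \<omega>)\<^sup>2)"
    proof -
      have eq: "g (X i \<omega>) * (e i \<omega>)\<^sup>2 = (r\<^sup>2 * g (X i \<omega>)) * (\<epsilon> i \<omega>)\<^sup>2" if "\<omega> \<in> space M" for \<omega>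
        by (simp add: e_eq[OF i that] power_mult_distrib)
      have eps2: "(\<lambda>\<omega>. (\<epsilon> i \<omega>)\<^sup>2) \<in> borel_measurable M" by measurable
      have "integrable M (\<lambda>\<omega>. (r\<^sup>2 * g (X i \<omega>)) * (\<epsilon> i \<omega>)\<^sup>2)"
        using int by (rule Bochner_Integration.integrable_cong[THEN iffD1, OF refl, rotated]) (rule eq)
      then have "(\<integral>\<omega>. (r\<^sup>2 * g (X i \<omega>)) * (\<epsilon> i \<omega>)\<^sup>2 \<partial>M) = \<sigma>\<^sup>2 * (\<integral>\<omega>. r\<^sup>2 * g (X i \<omega>) \<partial>M)"
        using integral_mult_cond_exp_const[OF XY(1)[OF i] eps2, of "\<lambda>x. r\<^sup>2 * g x", OF _ cond_var[OF i]] by simp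
      moreover have "(\<integral>\<omega>. g (X i \<omega>) * (e i \<omega>)\<^sup>2 \<partial>M) = (\<integral>\<omega>. (r\<^sup>2 * g (X i \<omega>)) * (\<epsilon> i \<omega>)\<^sup>2 \<partial>M)"
        by (rule Bochner_Integration.integral_cong[OF refl eq])
      ultimately show ?thesis unfolding q1 by simp
    qed
  qed (use p b_le in auto)
  have V_eq: "V i = regression_observation.V p (X i) (e i) b" if "i < n" for i
    unfolding V_def[abs_def] regression_observation.V_def[OF obs[OF that], abs_def]
      regression_observation.y_def[OF obs[OF that]]
    by (simp add: e_def)
  \<comment> \<open>The rescaled \<psi>. In w^2 = 4 (q + q^2) + 2 p / n the first term is n times
    the variance of the linear part (2/n) times the sum of b.V_i; the second is, to leading order, n
    times that of the quadratic part.\<close>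
  define w where "w = psi n p (sqnorm p \<beta>) (\<sigma>\<^sup>2) / s"
  define q where "q = sqnorm p b"
  have q0: "0 \<le> q" by (simp add: q_def sqnorm_nonneg)
  have n0: "0 < real n" and n1: "0 < real n - 1" using n by auto
  have p0: "0 < real p" using p by simp
  have t: "sqnorm p \<beta> = q * s" "\<sigma>\<^sup>2 = (1 - q) * s"
    using s unfolding q_def qb by (auto simp: s_def field_simps)
  have "2 * ((1 + real p / real n) * (\<sigma>\<^sup>2 + sqnorm p \<beta>)\<^sup>2 - (\<sigma>\<^sup>2)\<^sup>2 + 3 * (sqnorm p \<beta>)\<^sup>2)
      = s\<^sup>2 * (4 * (q + q\<^sup>2) + 2 * (real p / real n))"
    unfolding t by (simp add: power2_eq_square algebra_simps)
  then have psi: "psi n p (sqnorm p \<beta>) (\<sigma>\<^sup>2) = sqrt (s\<^sup>2 * (4 * (q + q\<^sup>2) + 2 * (real p / real n)))"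
    by (simp only: psi_def)
  have psi2: "(psi n p (sqnorm p \<beta>) (\<sigma>\<^sup>2))\<^sup>2 = s\<^sup>2 * (4 * (q + q\<^sup>2) + 2 * (real p / real n))"
    unfolding psi using q0 by (intro real_sqrt_pow2) auto
  have w2: "w\<^sup>2 = 4 * (q + q\<^sup>2) + 2 * (real p / real n)"
    unfolding w_def power_divide psi2 using s by simp
  have w2_pos: "0 < w\<^sup>2" unfolding w2 using q0 p0 n0 by (intro add_nonneg_pos) auto
  have w0: "0 < w"
  proof -
    have "0 \<le> w" unfolding w_def psi using s q0 by simp
    then show ?thesis using w2_pos by (cases "w = 0") auto
  qed
  \<comment> \<open>The weights 2 / n and 2 / (n (n - 1)) of the linear and quadratic parts,
    multiplied by sqrt n / w.\<close>
  define \<alpha> where "\<alpha> = 2 / (sqrt (real n) * w)"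
  define \<gamma> where "\<gamma> = 2 / (sqrt (real n) * (real n - 1) * w)"
  have \<alpha>2: "\<alpha>\<^sup>2 = 4 / (real n * w\<^sup>2)" using n0 by (simp add: \<alpha>_def power_divide power_mult_distrib)
  have \<gamma>2: "\<gamma>\<^sup>2 = 4 / (real n * (real n - 1)\<^sup>2 * w\<^sup>2)"
    using n0 by (simp add: \<gamma>_def power_divide power_mult_distrib)
  have w2_p: "2 * real p / real n \<le> w\<^sup>2" unfolding w2 using q0 by simp
  then have w2_p': "2 * real p / real n / w\<^sup>2 \<le> 1"
    using divide_le_eq_1_pos[OF w2_pos] by blast
  have sp: "spiked_sample M n p V b 107948 \<alpha> \<gamma>"
  proof
    have "indep_vars (\<lambda>_. Rvec p) (\<lambda>i \<omega>. (\<lambda>(x, y). \<lambda>j\<in>{..<p}. (r * y) * x j - b j) (X i \<omega>, Y i \<omega>)) {..<n}"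
      by (rule indep_vars_compose2[OF indep]) measurable
    then show "indep_vars (\<lambda>_. Rvec p) V {..<n}" by (simp add: V_def[abs_def])
    show "\<alpha>\<^sup>2 * sqnorm p b \<le> 1 / real n"
    proof -
      have "\<alpha>\<^sup>2 * q = (4 * q / w\<^sup>2) / real n" by (simp add: \<alpha>2)
      also have "\<dots> \<le> 1 / real n"
        using w2_pos q0 p0 n0 by (intro divide_right_mono) (auto simp: w2)
      finally show ?thesis by (simp add: q_def)
    qed
    show "\<gamma>\<^sup>2 * real p \<le> 8 / (real n)\<^sup>2"
    proof -
      have "\<gamma>\<^sup>2 * real p = (2 * real p / real n / w\<^sup>2) * (2 / (real n - 1)\<^sup>2)"
        by (simp add: \<gamma>2)
      also have "\<dots> \<le> 1 * (2 / (real n - 1)\<^sup>2)"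
        by (intro mult_right_mono w2_p') auto
      \<comment> \<open>The 8 arises from n <= 2 (n - 1), valid since n >= 2.\<close>
      also have "\<dots> = 8 / (2 * (real n - 1))\<^sup>2" unfolding power_mult_distrib by simp
      also have "\<dots> \<le> 8 / (real n)\<^sup>2"
        using n n0 by (intro divide_left_mono power_mono) auto
      finally show ?thesis .
    qed
    show "0 \<le> \<alpha>" "0 \<le> \<gamma>" using w0 n1 by (auto simp: \<alpha>_def \<gamma>_def)
  qed (use p b_le in \<open>auto simp: V_eq regression_observation.int_V4[OF obs] regression_observation.E_V4[OF obs]
      regression_observation.E_dot_V[OF obs] regression_observation.E_dot2_V[OF obs]
      regression_observation.E_dot4_V[OF obs]\<close>)
  interpret spiked_sample M n p V b 107948 \<alpha> \<gamma> by (rule sp)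
  have T: "T = S n"
  proof
    fix \<omega>
    have W: "W X Y i j \<omega> * W X Y k j \<omega> = s * ((V i \<omega> j + b j) * (V k \<omega> j + b j))" if "j < p" for i k j
    proof -
      have "(V i \<omega> j + b j) * (V k \<omega> j + b j) = r\<^sup>2 * (W X Y i j \<omega> * W X Y k j \<omega>)"
        using that by (simp add: V_def W_def power2_eq_square)
      then show ?thesis using s by (simp add: r(2))
    qed
    have "(\<Sum>j<p. \<Sum>i<n. \<Sum>k\<in>{..<n} - {i}. W X Y i j \<omega> * W X Y k j \<omega>)
        = s * (\<Sum>j<p. \<Sum>i<n. \<Sum>k\<in>{..<n} - {i}. (V i \<omega> j + b j) * (V k \<omega> j + b j))"
      by (simp add: W sum_distrib_left)
    also have "\<dots> = s * (2 * (\<Sum>i<n. dot p (P i \<omega>) (V i \<omega>)) + 2 * (real n - 1) * (\<Sum>i<n. dot p b (V i \<omega>))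
      + real n * (real n - 1) * q)"
      unfolding sum_off_diagonal_products q_def ..
    finally have sum: "(\<Sum>j<p. \<Sum>i<n. \<Sum>k\<in>{..<n} - {i}. W X Y i j \<omega> * W X Y k j \<omega>)
        = s * (2 * (\<Sum>i<n. dot p (P i \<omega>) (V i \<omega>)) + 2 * (real n - 1) * (\<Sum>i<n. dot p b (V i \<omega>))
          + real n * (real n - 1) * q)" .
    have "1 / (N * m) * (s * (2 * x + 2 * m * z + N * m * q)) = s * (2 / (N * m) * x + 2 / N * z + q)"
      if "0 < N" "0 < m" for N m x z :: real
      using that by (simp add: field_simps)
    from this[OF n0 n1] have "tau2_hat n p X Y \<omega> = s * (2 / (real n * (real n - 1)) * (\<Sum>i<n. dot p (P i \<omega>) (V i \<omega>))
        + 2 / real n * (\<Sum>i<n. dot p b (V i \<omega>)) + q)"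
      unfolding tau2_hat_def sum .
    moreover have "sqnorm p \<beta> = s * q" using s by (simp add: q_def qb)
    moreover have "psi n p (sqnorm p \<beta>) (\<sigma>\<^sup>2) = s * w" using s by (simp add: w_def)
    ultimately have "T \<omega> = sqrt (real n) * (2 / (real n * (real n - 1)) * (\<Sum>i<n. dot p (P i \<omega>) (V i \<omega>))
        + 2 / real n * (\<Sum>i<n. dot p b (V i \<omega>))) / w"
    proof -
      assume tau2: "tau2_hat n p X Y \<omega> = s * (2 / (real n * (real n - 1)) * (\<Sum>i<n. dot p (P i \<omega>) (V i \<omega>))
          + 2 / real n * (\<Sum>i<n. dot p b (V i \<omega>)) + q)"
        and sq: "sqnorm p \<beta> = s * q" and ps: "psi n p (sqnorm p \<beta>) (\<sigma>\<^sup>2) = s * w"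
      have "s * (x + z + q) - s * q = s * (x + z)" for x z
        by (simp add: algebra_simps)
      then show ?thesis
        unfolding T_def ps unfolding tau2 sq using s by simp
    qed
    also have "\<dots> = \<gamma> * (\<Sum>i<n. dot p (P i \<omega>) (V i \<omega>)) + \<alpha> * (\<Sum>i<n. dot p b (V i \<omega>))"
    proof -
      define h where "h = sqrt (real n)"
      have h: "0 < h" "real n = h * h" using n0 by (auto simp: h_def)
      have "h * (2 / (h * h * m) * x + 2 / (h * h) * z) / w = 2 / (h * m * w) * x + 2 / (h * w) * z"
        if "0 < m" for m x z
        using h(1) that w0 by (simp add: field_simps)
      from this[OF n1] show ?thesis
        unfolding \<alpha>_def \<gamma>_def h_def[symmetric] by (simp only: h(2))
    qed
    also have "\<dots> = S n \<omega>"
      unfolding S_def dot_add_left dot_scale_left by (simp add: sum.distrib sum_distrib_left)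
    finally show "T \<omega> = S n \<omega>" .
  qed
  show "T \<in> borel_measurable M" unfolding T by (rule rv_S) simp
  \<comment> \<open>The total variance misses 1 only because the quadratic part contributes 2 p / (n
    - 1) where \<psi> has 2 p / n.\<close>
  have "(\<Sum>i<n. v i) - 1 = 2 * real p / (real n * w\<^sup>2) / (real n - 1)"
  proof -
    have "(\<Sum>i<n. real i) = real n * (real n - 1) / 2"
      by (induction n) (simp_all add: field_simps)
    then have "(\<Sum>i<n. v i) = real n * (\<alpha>\<^sup>2 * (q + q\<^sup>2)) + \<gamma>\<^sup>2 * (real n * (real n - 1) / 2 * real p)"
      unfolding v_def q_def by (simp add: sum.distrib flip: sum_distrib_left sum_distrib_right)
    also have "\<dots> = (4 * (q + q\<^sup>2) + 2 * real p / (real n - 1)) / w\<^sup>2"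
    proof -
      have "N * (4 / (N * x) * A) + 4 / (N * m\<^sup>2 * x) * (N * m / 2 * P) = (4 * A + 2 * P / m) / x"
        if "0 < N" "0 < m" "0 < x" for N m x A P :: real
        using that by (simp add: field_simps power2_eq_square)
      from this[OF n0 n1 w2_pos] show ?thesis unfolding \<alpha>2 \<gamma>2 .
    qed
    also have "\<dots> = (w\<^sup>2 + 2 * real p / (real n * (real n - 1))) / w\<^sup>2"
    proof -
      have "2 * real p / (real n - 1) = 2 * (real p / real n) + 2 * real p / (real n * (real n - 1))"
        using n0 n1 by (simp add: field_simps)
      then show ?thesis unfolding w2 by (simp only: add.assoc)
    qed
    finally show ?thesis using w2_pos n0 n1 by (simp add: field_simps)
  qed
  moreover have "2 * real p / (real n * w\<^sup>2) \<le> 1"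
    using w2_p w2_pos n0 by (simp add: field_simps)
  moreover have "0 \<le> 2 * real p / (real n * w\<^sup>2)" using n0 by simp
  ultimately have "\<bar>(\<Sum>i<n. v i) - 1\<bar> \<le> 1 / (real n - 1)"
    using n1 by (simp only: abs_of_nonneg divide_nonneg_pos divide_right_mono less_imp_le)
  then show "cmod (char (distr M borel T) t - char std_normal_distribution t) \<le> char_error 107948 n p t"
    unfolding T using n by (intro char_S_bound) auto
qed

section \<open>Passage to the limit\<close>

lemma char_error_tendsto_0:
  assumes p: "filterlim p at_top sequentially"
  shows "(\<lambda>n. char_error K n (p n) t) \<longlonglongrightarrow> 0"
proof -
  have n: "(\<lambda>n. 1 / real n) \<longlonglongrightarrow> 0" by (rule lim_1_over_n)
  have p': "(\<lambda>n. 1 / real (p n)) \<longlonglongrightarrow> 0"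
    using n p by (rule filterlim_compose)
  have n1: "(\<lambda>n. 1 / (real n - 1)) \<longlonglongrightarrow> 0"
    by (rule LIMSEQ_imp_Suc) (use lim_1_over_n in simp)
  have "(\<lambda>n. 16 * sqrt (1 / real (p n)) + 8 * sqrt (2 * K * (1 / real n) + 32 * (1 / real (p n)))
      + 24 * (1 / real (p n))) \<longlonglongrightarrow> 16 * sqrt 0 + 8 * sqrt (2 * K * 0 + 32 * 0) + 24 * 0"
    by (intro tendsto_intros n p')
  then have var: "(\<lambda>n. variance_error K n (p n)) \<longlonglongrightarrow> 0"
    by (simp add: variance_error_def real_sqrt_divide)
  have "(\<lambda>n. t\<^sup>2 / 2 * variance_error K n (p n)
      + \<bar>t\<bar>^3 / 12 * ((10 + variance_error K n (p n) + K * fourth_moment_const K) * sqrt (1 / real n))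
      + 25 * t^4 / 2 * (1 / real n) + t\<^sup>2 / 2 * (1 / (real n - 1)))
    \<longlonglongrightarrow> t\<^sup>2 / 2 * 0 + \<bar>t\<bar>^3 / 12 * ((10 + 0 + K * fourth_moment_const K) * sqrt 0)
      + 25 * t^4 / 2 * 0 + t\<^sup>2 / 2 * 0"
    by (intro tendsto_intros n n1 var)
  then show ?thesis by (simp add: char_error_def real_sqrt_divide)
qed

theorem corollary1:
  fixes M :: "nat \<Rightarrow> 'a measure"
    and p :: "nat \<Rightarrow> nat"
    and \<beta> :: "nat \<Rightarrow> nat \<Rightarrow> real"
    and \<sigma> :: "nat \<Rightarrow> real"
    and X :: "nat \<Rightarrow> nat \<Rightarrow> 'a \<Rightarrow> nat \<Rightarrow> real"
    and Y \<epsilon> :: "nat \<Rightarrow> nat \<Rightarrow> 'a \<Rightarrow> real"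
    and \<tau>2 :: "nat \<Rightarrow> real"
  defines "\<tau>2 \<equiv> \<lambda>n. sqnorm (p n) (\<beta> n)"
  assumes prob: "\<And>n. n \<ge> 1 \<Longrightarrow> prob_space (M n)"
    and indep: "\<And>n. n \<ge> 1 \<Longrightarrow>
      prob_space.indep_vars (M n) (\<lambda>_. Rvec (p n) \<Otimes>\<^sub>M borel) (\<lambda>i \<omega>. (X n i \<omega>, Y n i \<omega>)) {..<n}"
    and ident: "\<And>n i k. i < n \<Longrightarrow> k < n \<Longrightarrow>
      distr (M n) (Rvec (p n) \<Otimes>\<^sub>M borel) (\<lambda>\<omega>. (X n i \<omega>, Y n i \<omega>)) =
      distr (M n) (Rvec (p n) \<Otimes>\<^sub>M borel) (\<lambda>\<omega>. (X n k \<omega>, Y n k \<omega>))"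
    and model: "\<And>n i \<omega>. i < n \<Longrightarrow> \<omega> \<in> space (M n) \<Longrightarrow>
      Y n i \<omega> = (\<Sum>j<p n. \<beta> n j * X n i \<omega> j) + \<epsilon> n i \<omega>"
    and cond_mean: "\<And>n i. i < n \<Longrightarrow>
      AE \<omega> in M n. real_cond_exp (M n) (sigma_gen (M n) (p n) (X n i)) (\<epsilon> n i) \<omega> = 0"
    and cond_var: "\<And>n i. i < n \<Longrightarrow>
      AE \<omega> in M n. real_cond_exp (M n) (sigma_gen (M n) (p n) (X n i)) (\<lambda>\<omega>. (\<epsilon> n i \<omega>)\<^sup>2) \<omega> = (\<sigma> n)\<^sup>2"
    and X_normal: "\<And>n i. i < n \<Longrightarrow> distr (M n) (Rvec (p n)) (X n i) = std_normal_vec (p n)"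
    and eps_normal: "\<And>n i. i < n \<Longrightarrow> distr (M n) borel (\<epsilon> n i) = normal_distr 0 (\<sigma> n)"
    and sigma_nonneg: "\<And>n. n \<ge> 1 \<Longrightarrow> \<sigma> n \<ge> 0"
    and pos: "\<And>n. n \<ge> 1 \<Longrightarrow> \<tau>2 n + (\<sigma> n)\<^sup>2 > 0"
    and bounded: "\<exists>B. \<forall>n\<ge>1. \<tau>2 n + (\<sigma> n)\<^sup>2 \<le> B"
    and p_top: "filterlim p at_top sequentially"
    and ratio: "convergent (\<lambda>n. real (p n) / real n)"
  shows "weak_conv_m
    (\<lambda>n. distr (M n) borel
      (\<lambda>\<omega>. sqrt (real n) *
        ((tau2_hat n (p n) (X n) (Y n) \<omega> - \<tau>2 n) / psi n (p n) (\<tau>2 n) ((\<sigma> n)\<^sup>2))))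
    std_normal_distribution"
proof -
  define T where "T n \<omega> = sqrt (real n) *
        ((tau2_hat n (p n) (X n) (Y n) \<omega> - \<tau>2 n) / psi n (p n) (\<tau>2 n) ((\<sigma> n)\<^sup>2))" for n \<omega>
  have good: "\<forall>\<^sub>F n in sequentially. 2 \<le> n \<and> 0 < p n"
    using eventually_ge_at_top[of 2] filterlim_at_top[THEN iffD1, OF p_top, rule_format, of 1]
    by eventually_elim simp
  have T: "T n \<in> borel_measurable (M n)"
    "cmod (char (distr (M n) borel (T n)) t - char std_normal_distribution t) \<le> char_error 107948 n (p n) t"
    if n: "2 \<le> n \<and> 0 < p n" for n t
    unfolding T_def[abs_def] \<tau>2_def
    by (rule char_statistic[where \<epsilon>="\<epsilon> n"];
        use n prob indep model cond_mean cond_var X_normal eps_normal sigma_nonneg pos in \<open>auto simp: \<tau>2_def\<close>)+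
  \<comment> \<open>for small \<open>n\<close> the law may fail to be a probability measure, so Levy's theorem is applied to a modified sequence\<close>
  define \<mu> where "\<mu> n = (if 2 \<le> n \<and> 0 < p n then distr (M n) borel (T n) else std_normal_distribution)" for n
  have "weak_conv_m \<mu> std_normal_distribution"
  proof (rule levy_continuity)
    show "real_distribution (\<mu> n)" for n
      using prob_space.real_distribution_distr[OF prob T(1)] real_dist_normal_dist by (auto simp: \<mu>_def)
    show "real_distribution std_normal_distribution" by (rule real_dist_normal_dist)
    fix t
    have "\<forall>\<^sub>F n in sequentially. cmod (char (\<mu> n) t - char std_normal_distribution t) \<le> char_error 107948 n (p n) t"
      using good by eventually_elim (simp add: \<mu>_def T(2))
    then have "(\<lambda>n. char (\<mu> n) t - char std_normal_distribution t) \<longlonglongrightarrow> 0"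
      by (rule Lim_null_comparison) (rule char_error_tendsto_0[OF p_top])
    then show "(\<lambda>n. char (\<mu> n) t) \<longlonglongrightarrow> char std_normal_distribution t"
      by (simp add: LIM_zero_iff)
  qed
  \<comment> \<open>Weak convergence is pointwise convergence of distribution functions, which is
    unaffected by finitely many modified terms.\<close>
  moreover have "\<forall>\<^sub>F n in sequentially. cdf (\<mu> n) x = cdf (distr (M n) borel (T n)) x" for x
    using good by eventually_elim (simp add: \<mu>_def)
  note this[THEN tendsto_cong]
  ultimately have "weak_conv_m (\<lambda>n. distr (M n) borel (T n)) std_normal_distribution"
    by (simp add: weak_conv_m_def weak_conv_def)
  then show ?thesis by (simp only: T_def[abs_def])
qed

end
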